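(* Fix $k\ge 2$. Let $p$ be a full rook placement on a Ferrers board $\lambda$ that contains $k\cdots 21$ and for which the A-sequence and the B-sequence do not coincide. Then $\phi(p)$ and $\psi(p)$ still contain the pattern $k\cdots 21$, and $\phi(\psi(p))=\psi(\phi(p))$.
   Context: A Ferrers board $\lambda$ is a finite set of cells $(i,j)$ ($i$ = column, $j$ = row) closed under decreasing either coordinate (staying positive). A full rook placement on $\lambda$ is a set of cells (dots) with exactly one dot in each row and each column of $\lambda$; its permutation $\pi$ has $\pi(i)=j$ iff $(i,j)$ is a dot. An occurrence of $k\cdots 21$ in $p$ is a choice of dots at positions $i_1<\cdots<i_k$ with $\pi_{i_1}>\cdots>\pi_{i_k}$ and $(i_k,\pi_{i_1})\in\lambda$. The A-sequence $a_k\cdots a_1$ of $p$ is the occurrence of $k\cdots21$ whose value sequence is lexicographically smallest. The B-sequence $b_k\cdots b_1$ is defined recursively: $b_1$ is the leftmost dot that is the last dot of an occurrence of $k\cdots 21$, and for $j\ge2$, $b_j$ is the leftmost dot such that $b_j b_{j-1}\cdots b_1$ ends an occurrence of $k\cdots 21$. For a chosen occurrence with values $v_1>\cdots>v_k$ at positions $i_1<\cdots<i_k$, cyclically shifting it means placing values $v_2,\ldots,v_k,v_1$ at positions $i_1,\ldots,i_k$ (other dots unchanged). $\phi(p)$ (the A-shift) cyclically shifts the A-sequence, and $\psi(p)$ (the B-shift) cyclically shifts the B-sequence; if $p$ avoids $k\cdots 21$ then $\phi(p)=\psi(p)=p$. (Equivalently $\psi(p)=\phi(p')'$ where $'$ denotes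 reflection in the main diagonal.) *)

theory Defs
  imports Main
begin

text \<open>Cells are pairs (column, row) of positive natural numbers.\<close>

definition ferrers_board :: "(nat \<times> nat) set \<Rightarrow> bool" where
  "ferrers_board L \<longleftrightarrow> finite L \<and>
     (\<forall>(i, j) \<in> L. 1 \<le> i \<and> 1 \<le> j) \<and>
     (\<forall>(i, j) \<in> L. \<forall>i' j'. 1 \<le> i' \<and> i' \<le> i \<and> 1 \<le> j' \<and> j' \<le> j \<longrightarrow> (i', j') \<in> L)"

definition full_rook_placement :: "(nat \<times> nat) set \<Rightarrow> (nat \<times> nat) set \<Rightarrow> bool" where
  "full_rook_placement L p \<longleftrightarrow> p \<subseteq> L \<and>
     (\<forall>i \<in> fst ` L. \<exists>!j. (i, j) \<in> p) \<and>
     (\<forall>j \<in> snd ` L. \<exists>!i. (i, j) \<in> p)"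

text \<open>
  An occurrence of \<open>k\<cdots>21\<close> is the list of its dots from left to right; its position sequence
  is \<open>map fst ds\<close> and its value sequence is \<open>map snd ds\<close>.  The last conjunct requires the
  upper right corner of the rectangle spanned by the dots to lie on the board.
\<close>

definition occurrence ::
    "nat \<Rightarrow> (nat \<times> nat) set \<Rightarrow> (nat \<times> nat) set \<Rightarrow> (nat \<times> nat) list \<Rightarrow> bool" where
  "occurrence k L p ds \<longleftrightarrow> length ds = k \<and> set ds \<subseteq> p \<and>
     sorted_wrt (\<lambda>c d. fst c < fst d \<and> snd c > snd d) ds \<and>
     (fst (last ds), snd (hd ds)) \<in> L"

definition contains_pattern ::
    "nat \<Rightarrow> (nat \<times> nat) set \<Rightarrow> (nat \<times> nat) set \<Rightarrow> bool" where
  "contains_pattern k L p \<longleftrightarrow> (\<exists>ds. occurrence k L p ds)"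

text \<open>\<open>lexordp_eq\<close> is the reflexive lexicographic order on lists.\<close>

definition A_sequence ::
    "nat \<Rightarrow> (nat \<times> nat) set \<Rightarrow> (nat \<times> nat) set \<Rightarrow> (nat \<times> nat) list" where
  "A_sequence k L p = (THE ds. occurrence k L p ds \<and>
     (\<forall>es. occurrence k L p es \<longrightarrow> lexordp_eq (map snd ds) (map snd es)))"

text \<open>
  \<open>B_suffix k L p j\<close> is the list \<open>[b\<^sub>j, \<dots>, b\<^sub>1]\<close>.  For \<open>j = 0\<close> the recursion step chooses
  the leftmost dot that is the last dot of an occurrence.
\<close>

primrec B_suffix ::
    "nat \<Rightarrow> (nat \<times> nat) set \<Rightarrow> (nat \<times> nat) set \<Rightarrow> nat \<Rightarrow> (nat \<times> nat) list" where
  "B_suffix k L p 0 = []"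
| "B_suffix k L p (Suc j) =
     (ARG_MIN fst d. \<exists>es. occurrence k L p (es @ d # B_suffix k L p j)) # B_suffix k L p j"

definition B_sequence ::
    "nat \<Rightarrow> (nat \<times> nat) set \<Rightarrow> (nat \<times> nat) set \<Rightarrow> (nat \<times> nat) list" where
  "B_sequence k L p = B_suffix k L p k"

definition cyclic_shift ::
    "(nat \<times> nat) set \<Rightarrow> (nat \<times> nat) list \<Rightarrow> (nat \<times> nat) set" where
  "cyclic_shift p ds = (p - set ds) \<union> set (zip (map fst ds) (rotate1 (map snd ds)))"

definition A_shift :: "nat \<Rightarrow> (nat \<times> nat) set \<Rightarrow> (nat \<times> nat) set \<Rightarrow> (nat \<times> nat) set" where
  "A_shift k L p =
     (if contains_pattern k L p then cyclic_shift p (A_sequence k L p) else p)"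

definition B_shift :: "nat \<Rightarrow> (nat \<times> nat) set \<Rightarrow> (nat \<times> nat) set \<Rightarrow> (nat \<times> nat) set" where
  "B_shift k L p =
     (if contains_pattern k L p then cyclic_shift p (B_sequence k L p) else p)"

end

(*
  The idea is to describe how each sequence moves under the other shift.  If A and B are disjoint,
  neither is affected.  Otherwise they share a block C of consecutive dots; A enters C from the
  left of B and leaves it to the right of B.  In the B-shift, the new A-sequence passes from the
  part of A before C to the dot in the column of the predecessor u of C in B and the row of hd C,
  and then follows the componentwise least chain ys of maximal length in the rectangle between
  u and the successor w of C in A.  The description of the B-sequence of the A-shift is the mirror
  image, with the same chain ys, since both shifts agree in that rectangle.  Hence both
  compositions consist of the same dots.
*)
theory Submission
  imports Defs
begin

section \<open>Chains of dots\<close>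

text \<open>The minimality of \<open>A\<close> and \<open>B\<close> says nothing about dots that a
  shift creates, so the core is to carry chains of the B-shift back into \<open>p\<close>. Every new
  dot but one lies in the row of a dot of \<open>B\<close>, to the left of it. It is moved right to
  that dot, and if it then overtakes the rest of the chain, the rest is pushed onto
  \<open>B\<close>. The exceptional dot, in the top row of \<open>B\<close>, is too high to occur in
  a chain that could undercut the new A-sequence. A chain carried back is refuted by minimality of
  \<open>A\<close> or \<open>B\<close>, or by having more than \<open>k\<close> dots under the
  corner of \<open>A\<close>. The last argument also fixes the length of \<open>ys\<close>: the new
  dots that the shift puts between consecutive dots of \<open>C\<close> form a chain of
  \<open>length C - 1\<close> dots in the rectangle, and a chain of \<open>length C\<close> dots
  there would lengthen \<open>A\<close>. Both sequences are characterised by conditions on all ways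
  of cutting them in two. These conditions are exchanged by reflection, so that only the B-shift has
  to be treated directly.\<close>

definition chain :: "(nat \<times> nat) list \<Rightarrow> bool" where
  "chain = sorted_wrt (\<lambda>c d. fst c < fst d \<and> snd c > snd d)"

lemma chain_Nil [simp]: "chain []"
  by (simp add: chain_def)

lemma chain_Cons:
  "chain (x # xs) \<longleftrightarrow> chain xs \<and> (xs \<noteq> [] \<longrightarrow> fst x < fst (hd xs) \<and> snd (hd xs) < snd x)"
proof (cases xs)
  case (Cons y ys)
  have "transp (\<lambda>c d :: nat \<times> nat. fst c < fst d \<and> snd c > snd d)"
    by (rule transpI) auto
  then show ?thesis
    unfolding chain_def Cons sorted_wrt2[OF \<open>transp _\<close>] list.sel by blast
qed (simp add: chain_def)

lemma chain_append:
  "chain (xs @ ys) \<longleftrightarrow> chain xs \<and> chain ys \<and>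
     (xs \<noteq> [] \<longrightarrow> ys \<noteq> [] \<longrightarrow> fst (last xs) < fst (hd ys) \<and> snd (hd ys) < snd (last xs))"
  by (induction xs) (auto simp: chain_Cons hd_append)

lemma chain_glue: "chain (xs @ c # ys) \<longleftrightarrow> chain (xs @ [c]) \<and> chain (c # ys)"
  by (auto simp: chain_append chain_Cons)

lemma chain_take: "chain xs \<Longrightarrow> chain (take n xs)"
  using chain_append[of "take n xs" "drop n xs"] by simp

lemma chain_drop: "chain xs \<Longrightarrow> chain (drop n xs)"
  using chain_append[of "take n xs" "drop n xs"] by simp

lemma chain_nth:
  "chain xs \<Longrightarrow> i < j \<Longrightarrow> j < length xs \<Longrightarrow> fst (xs ! i) < fst (xs ! j) \<and> snd (xs ! j) < snd (xs ! i)"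
  by (auto simp: chain_def sorted_wrt_iff_nth_less)

lemma chain_nth_fst: "chain xs \<Longrightarrow> i < length xs \<Longrightarrow> j < length xs \<Longrightarrow>
    fst (xs ! i) < fst (xs ! j) \<longleftrightarrow> i < j"
  using chain_nth[of xs i j] chain_nth[of xs j i] by (cases i j rule: linorder_cases) auto

lemma chain_nth_snd: "chain xs \<Longrightarrow> i < length xs \<Longrightarrow> j < length xs \<Longrightarrow>
    snd (xs ! i) < snd (xs ! j) \<longleftrightarrow> j < i"
  using chain_nth[of xs i j] chain_nth[of xs j i] by (cases i j rule: linorder_cases) auto

lemma chain_bounds:
  assumes "chain xs" "x \<in> set xs"
  shows "fst (hd xs) \<le> fst x" "fst x \<le> fst (last xs)" "snd (last xs) \<le> snd x" "snd x \<le> snd (hd xs)"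
proof -
  obtain i where i: "i < length xs" "x = xs ! i"
    using assms(2) by (metis in_set_conv_nth)
  have ne: "xs \<noteq> []" using i by auto
  have "i = 0 \<or> 0 < i" "i = length xs - 1 \<or> i < length xs - 1" using i by auto
  then show "fst (hd xs) \<le> fst x" "snd x \<le> snd (hd xs)" "fst x \<le> fst (last xs)" "snd (last xs) \<le> snd x"
    using chain_nth[OF assms(1), of 0 i] chain_nth[OF assms(1), of i "length xs - 1"] i(1)
    unfolding hd_conv_nth[OF ne] last_conv_nth[OF ne] i(2) by (auto simp: less_imp_le)
qed

lemma chain_distinct: "chain xs \<Longrightarrow> distinct (map fst xs) \<and> distinct (map snd xs)"
proof (induction xs)
  case (Cons x xs)
  then have "\<forall>d \<in> set xs. fst x < fst d \<and> snd d < snd x" by (simp add: chain_def)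
  then show ?case using Cons by (force simp: chain_Cons)
qed simp

section \<open>Occurrences and the dots created by a shift\<close>

lemma occurrence_iff: "occurrence k L p ds \<longleftrightarrow>
    length ds = k \<and> set ds \<subseteq> p \<and> chain ds \<and> (fst (last ds), snd (hd ds)) \<in> L"
  by (simp add: occurrence_def chain_def)

text \<open>In a cyclic shift every column but the last receives the row of the next dot; these are
  the dots so created. The remaining one, in the last column and the top row, is kept apart because
  it alone moves upwards.\<close>

definition links :: "(nat \<times> nat) list \<Rightarrow> (nat \<times> nat) list" where
  "links ds = zip (map fst ds) (map snd (tl ds))"

lemma length_links [simp]: "length (links ds) = length ds - 1"
  by (simp add: links_def)

lemma nth_links: "Suc i < length ds \<Longrightarrow> links ds ! i = (fst (ds ! i), snd (ds ! Suc i))"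
  by (simp add: links_def nth_tl)

lemma links_simps [simp]:
  "links [] = []" "links [x] = []" "links (x # y # zs) = (fst x, snd y) # links (y # zs)"
  by (simp_all add: links_def)

lemma links_append:
  "xs \<noteq> [] \<Longrightarrow> ys \<noteq> [] \<Longrightarrow> links (xs @ ys) = links xs @ (fst (last xs), snd (hd ys)) # links ys"
proof (induction xs)
  case (Cons x xs)
  then show ?case by (cases xs; cases ys) auto
qed simp

lemma chain_links: "chain xs \<Longrightarrow> chain (links xs)"
proof (induction xs)
  case (Cons x xs)
  show ?case
  proof (cases xs)
    case Nil then show ?thesis by simp
  next
    case (Cons y ys)
    then show ?thesis using Cons.IH Cons.prems by (cases ys) (auto simp: chain_Cons)
  qed
qed simp

lemma in_linksE:
  assumes "z \<in> set (links ds)"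
  obtains xs c d ys where "ds = xs @ c # d # ys" "z = (fst c, snd d)"
proof -
  from assms obtain i where i: "Suc i < length ds" "z = links ds ! i"
    by (auto simp: in_set_conv_nth less_diff_conv)
  have "ds = take i ds @ ds ! i # ds ! Suc i # drop (Suc (Suc i)) ds"
    by (metis Cons_nth_drop_Suc Suc_lessD append_take_drop_id i(1))
  then show ?thesis using that i nth_links by metis
qed

lemma cyclic_shift_eq:
  assumes "ds \<noteq> []"
  shows "cyclic_shift p ds = (p - set ds) \<union> set (links ds) \<union> {(fst (last ds), snd (hd ds))}"
proof -
  obtain d es where ds: "ds = d # es" using assms by (cases ds) auto
  have "zip (map fst ds) (rotate1 (map snd ds)) = links ds @ [(fst (last ds), snd (hd ds))]"
    unfolding links_def ds by (rule nth_equalityI) (auto simp: nth_append last_conv_nth nth_Cons' less_Suc_eq)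
  then show ?thesis by (simp add: cyclic_shift_def Un_assoc)
qed

text \<open>A kept element that collides with a new one would share its value with a removed element
  of \<open>p\<close>. The statement with a general \<open>f\<close> serves rows and columns
  alike.\<close>

lemma inj_on_diff_Un:
  assumes "inj_on f p" "inj_on f N" "A \<subseteq> p" "f ` N = f ` A"
  shows "inj_on f (p - A \<union> N)"
proof (rule inj_onI)
  fix x y assume xy: "x \<in> p - A \<union> N" "y \<in> p - A \<union> N" "f x = f y"
  have sep: "f c \<noteq> f d" if "c \<in> p - A" "d \<in> N" for c d
  proof
    assume "f c = f d"
    moreover have "f d \<in> f ` A" using that(2) assms(4) by blast
    ultimately obtain e where "e \<in> A" "f c = f e" by auto
    then have "c = e" using that(1) assms(3) by (auto intro: inj_onD[OF assms(1)])
    then show False using that \<open>e \<in> A\<close> by blast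
  qed
  then show "x = y" using xy assms(1,2) by (metis DiffD1 Un_iff inj_onD)
qed

lemma inj_on_cyclic_shift:
  assumes "inj_on fst p" "inj_on snd p" "set ds \<subseteq> p" "chain ds"
  shows "inj_on fst (cyclic_shift p ds)" "inj_on snd (cyclic_shift p ds)"
proof -
  let ?n = "zip (map fst ds) (rotate1 (map snd ds))"
  have len: "length (map fst ds) = length (rotate1 (map snd ds))" by simp
  have f: "map fst ?n = map fst ds" "map snd ?n = rotate1 (map snd ds)"
    using len by (simp_all only: map_fst_zip map_snd_zip)
  have "distinct (map fst ?n)" "distinct (map snd ?n)"
    using chain_distinct[OF assms(4)] unfolding f by simp_all
  then have n: "inj_on fst (set ?n)" "inj_on snd (set ?n)" by (simp_all only: distinct_map)
  have "fst ` set ?n = fst ` set ds" "snd ` set ?n = snd ` set ds"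
    by (metis f(1) list.set_map) (metis f(2) list.set_map set_rotate1)
  then show "inj_on fst (cyclic_shift p ds)" "inj_on snd (cyclic_shift p ds)"
    unfolding cyclic_shift_def by (intro inj_on_diff_Un n assms(1-3); simp)+
qed

text \<open>Both coordinates are treated alike, so that after reflection the same list can serve the
  other shift.\<close>

definition least_chain :: "(nat \<times> nat) set \<Rightarrow> nat \<Rightarrow> (nat \<times> nat) list \<Rightarrow> bool" where
  "least_chain Q n ys \<longleftrightarrow> chain ys \<and> set ys \<subseteq> Q \<and> length ys = n \<and>
     (\<forall>gs. chain gs \<and> set gs \<subseteq> Q \<and> length gs = n \<longrightarrow>
        (\<forall>i<n. fst (ys ! i) \<le> fst (gs ! i) \<and> snd (ys ! i) \<le> snd (gs ! i)))"

text \<open>Chains of maximal length form a meet semilattice: dots of equal index are never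
  northwest of each other, as otherwise a longer chain could be spliced together.\<close>

lemma least_chain_exists:
  assumes inj: "inj_on fst Q" "inj_on snd Q"
    and max: "\<And>gs. chain gs \<Longrightarrow> set gs \<subseteq> Q \<Longrightarrow> length gs \<noteq> Suc n"
    and ex: "chain gs" "set gs \<subseteq> Q" "length gs = n"
  shows "\<exists>ys. least_chain Q n ys"
proof -
  let ?C = "\<lambda>gs. chain gs \<and> set gs \<subseteq> Q \<and> length gs = n"
  \<comment> \<open>The least column sum only selects a candidate; comparison with meets will show
    that it is least at every index.\<close>
  define ys where "ys = (ARG_MIN (\<lambda>gs. sum_list (map fst gs)) gs. ?C gs)"
  have ys: "?C ys" and ysmin: "\<And>gs. ?C gs \<Longrightarrow> sum_list (map fst ys) \<le> sum_list (map fst gs)"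
    using arg_min_nat_lemma[of ?C gs "\<lambda>gs. sum_list (map fst gs)"] ex unfolding ys_def by auto
  have no: "\<not> (fst (g ! i) < fst (h ! i) \<and> snd (h ! i) < snd (g ! i))"
    if "?C g" "?C h" "i < n" for g h i
  proof
    assume nw: "fst (g ! i) < fst (h ! i) \<and> snd (h ! i) < snd (g ! i)"
    \<comment> \<open>Both dots of index \<open>i\<close> are kept, hence the extra length.\<close>
    let ?l = "take (Suc i) g @ drop i h"
    have "chain ?l"
      using that nw by (simp add: chain_append chain_take chain_drop last_conv_nth hd_drop_conv_nth)
    moreover have "set ?l \<subseteq> Q" using that set_take_subset set_drop_subset by (metis Un_least set_append subset_trans)
    moreover have "length ?l = Suc n" using that by simp
    ultimately show False using max by blast
  qed
  have cmp: "(fst (g ! i) \<le> fst (h ! i) \<and> snd (g ! i) \<le> snd (h ! i)) \<or>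
      (fst (h ! i) \<le> fst (g ! i) \<and> snd (h ! i) \<le> snd (g ! i))"
    if "?C g" "?C h" "i < n" for g h i
  proof -
    have "g ! i \<in> Q" "h ! i \<in> Q" using that by auto
    then have "fst (g ! i) = fst (h ! i) \<longleftrightarrow> snd (g ! i) = snd (h ! i)"
      using inj by (metis inj_onD)
    then show ?thesis using no[OF that] no[OF that(2,1,3)] by linarith
  qed
  have "fst (ys ! i) \<le> fst (gs ! i) \<and> snd (ys ! i) \<le> snd (gs ! i)" if g: "?C gs" and i: "i < n" for gs i
  proof -
    \<comment> \<open>The meet of \<open>ys\<close> and \<open>gs\<close>: by \<open>cmp\<close>,
      the dot with the smaller column also has the smaller row.\<close>
    define m where "m = map (\<lambda>i. if fst (ys ! i) \<le> fst (gs ! i) then ys ! i else gs ! i) [0..<n]"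
    have lm: "length m = n" by (simp add: m_def)
    have mfst: "fst (m ! i) = min (fst (ys ! i)) (fst (gs ! i))" if "i < n" for i
      using that by (simp add: m_def)
    have msnd: "snd (m ! i) = min (snd (ys ! i)) (snd (gs ! i))" if "i < n" for i
    proof -
      have "ys ! i \<in> Q" "gs ! i \<in> Q" using that g ys by auto
      then have "fst (ys ! i) = fst (gs ! i) \<Longrightarrow> ys ! i = gs ! i" using inj(1) by (metis inj_onD)
      then show ?thesis using cmp[OF ys g that] that by (auto simp: m_def)
    qed
    have "chain m"
      unfolding chain_def sorted_wrt_iff_nth_less
    proof (intro allI impI)
      fix i j assume ij: "i < j" "j < length m"
      then show "fst (m ! i) < fst (m ! j) \<and> snd (m ! i) > snd (m ! j)"
        using chain_nth[of ys i j] chain_nth[of gs i j] ys g lm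
        by (auto simp: mfst msnd)
    qed
    moreover have "set m \<subseteq> Q" using ys g by (auto simp: m_def)
    ultimately have le: "sum_list (map fst ys) \<le> sum_list (map fst m)" using ysmin lm by blast
    have "fst (ys ! i) = fst (m ! i)"
    proof (rule ccontr)
      assume "fst (ys ! i) \<noteq> fst (m ! i)"
      then have "fst (m ! i) < fst (ys ! i)" using mfst i by simp
      then have "(\<Sum>j<n. fst (m ! j)) < (\<Sum>j<n. fst (ys ! j))"
        using mfst i by (intro sum_strict_mono_ex1) auto
      then show False using le ys lm by (simp add: sum_list_sum_nth atLeast0LessThan)
    qed
    then have f: "fst (ys ! i) \<le> fst (gs ! i)" using mfst i by simp
    moreover have "ys ! i \<in> Q" "gs ! i \<in> Q" using i g ys by auto
    then have "fst (ys ! i) = fst (gs ! i) \<Longrightarrow> ys ! i = gs ! i" using inj(1) by (metis inj_onD)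
    ultimately show ?thesis using cmp[OF ys g i] by auto
  qed
  then show ?thesis using ys unfolding least_chain_def by blast
qed

section \<open>Greedy occurrences\<close>

text \<open>Lexicographic minimality split into single choices: no occurrence that shares the prefix
  \<open>X\<close> continues in a lower row. Cutting the list instead of indexing it makes
  \<open>greedyB\<close> the literal mirror image, which matches the recursion for the
  B-sequence.\<close>

definition greedyA :: "nat \<Rightarrow> (nat \<times> nat) set \<Rightarrow> (nat \<times> nat) set \<Rightarrow> (nat \<times> nat) list \<Rightarrow> bool" where
  "greedyA k L p ds \<longleftrightarrow> occurrence k L p ds \<and>
     (\<forall>X Y E. ds = X @ Y \<and> Y \<noteq> [] \<and> occurrence k L p (X @ E) \<longrightarrow> snd (hd Y) \<le> snd (hd E))"

definition greedyB :: "nat \<Rightarrow> (nat \<times> nat) set \<Rightarrow> (nat \<times> nat) set \<Rightarrow> (nat \<times> nat) list \<Rightarrow> bool" where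
  "greedyB k L p ds \<longleftrightarrow> occurrence k L p ds \<and>
     (\<forall>X Y E. ds = Y @ X \<and> Y \<noteq> [] \<and> occurrence k L p (E @ X) \<longrightarrow> fst (last Y) \<le> fst (last E))"

text \<open>When the first rows agree, distinct rows make the first dots equal, and this dot moves
  into the common prefix.\<close>

lemma greedyA_lexordp_eq:
  assumes g: "greedyA k L p (X @ Y)" and es: "occurrence k L p (X @ E)" and inj: "inj_on snd p"
  shows "lexordp_eq (map snd Y) (map snd E)"
  using assms(1,2)
proof (induction Y arbitrary: X E)
  case (Cons y Y)
  have "length E = length (y # Y)"
    using Cons.prems by (auto simp: greedyA_def occurrence_iff)
  then obtain e E' where E: "E = e # E'" by (cases E) auto
  have "snd y \<le> snd e" using Cons.prems unfolding greedyA_def E by fastforce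
  moreover have "lexordp_eq (map snd Y) (map snd E')" if "snd y = snd e"
  proof -
    have "y \<in> p" "e \<in> p" using Cons.prems by (auto simp: greedyA_def occurrence_iff E)
    then have "y = e" using that inj by (metis inj_onD)
    then show ?thesis using Cons.IH[of "X @ [y]" E'] Cons.prems E by simp
  qed
  ultimately show ?case by (cases "snd y = snd e") (auto simp: E)
qed (simp add: lexordp_eq.intros)

lemma greedyA_unique:
  assumes "greedyA k L p ds" "inj_on snd p" "occurrence k L p es"
    and "lexordp_eq (map snd es) (map snd ds)"
  shows "es = ds"
proof -
  have "lexordp_eq (map snd ds) (map snd es)"
    using greedyA_lexordp_eq[of k L p "[]"] assms by simp
  then have "map snd es = map snd ds" using assms(4) by (metis lexordp_eq_antisym)
  moreover have "inj_on snd (set es \<union> set ds)"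
    using assms by (auto simp: greedyA_def occurrence_iff intro: inj_on_subset)
  ultimately show ?thesis by (simp add: inj_on_map_eq_map)
qed

lemma A_sequence_eqI:
  assumes "greedyA k L p ds" "inj_on snd p"
  shows "A_sequence k L p = ds"
  unfolding A_sequence_def
proof (rule the_equality)
  show "occurrence k L p ds \<and> (\<forall>es. occurrence k L p es \<longrightarrow> lexordp_eq (map snd ds) (map snd es))"
    using assms greedyA_lexordp_eq[of k L p "[]"] by (auto simp: greedyA_def)
  fix es assume "occurrence k L p es \<and> (\<forall>ds. occurrence k L p ds \<longrightarrow> lexordp_eq (map snd es) (map snd ds))"
  then show "es = ds" using greedyA_unique[OF assms] assms(1) by (simp add: greedyA_def)
qed

text \<open>\<open>ARG_MIN\<close> picks some minimiser, so the leftmost dot must be shown to be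
  unique; this is where distinct columns enter.\<close>

lemma B_sequence_eqI:
  assumes g: "greedyB k L p ds" and inj: "inj_on fst p"
  shows "B_sequence k L p = ds"
proof -
  have len: "length ds = k" using g by (simp add: greedyB_def occurrence_iff)
  have "B_suffix k L p j = drop (k - j) ds" if "j \<le> k" for j
    using that
  proof (induction j)
    case (Suc j)
    let ?X = "drop (k - j) ds" and ?Y = "take (k - j) ds"
    have ne: "?Y \<noteq> []" using Suc.prems len by auto
    have IH: "B_suffix k L p j = ?X" using Suc by simp
    let ?P = "\<lambda>d. \<exists>es. occurrence k L p (es @ d # ?X)"
    have split: "butlast ?Y @ last ?Y # ?X = ds"
      using append_butlast_last_id[OF ne] append_take_drop_id[of "k - j" ds]
      by (metis append.assoc append_Cons append_Nil)
    have "occurrence k L p (butlast ?Y @ last ?Y # ?X)"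
      unfolding split using g by (simp add: greedyB_def)
    then have P: "?P (last ?Y)" by blast
    have min: "fst (last ?Y) \<le> fst d" if "?P d" for d
    proof -
      from that obtain es where "occurrence k L p ((es @ [d]) @ ?X)" by auto
      moreover have "ds = ?Y @ ?X" by simp
      ultimately have "fst (last ?Y) \<le> fst (last (es @ [d]))" using g ne unfolding greedyB_def by blast
      then show ?thesis by simp
    qed
    have "(ARG_MIN fst d. ?P d) = last ?Y"
      unfolding arg_min_def
    proof (rule some_equality)
      show "is_arg_min fst ?P (last ?Y)" using P min by (auto simp: is_arg_min_linorder)
      fix d assume "is_arg_min fst ?P d"
      then have d: "?P d" "fst d \<le> fst (last ?Y)"
        using P unfolding is_arg_min_linorder by blast+
      then have "fst d = fst (last ?Y)" using min by (simp add: le_antisym)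
      moreover have "d \<in> p" "last ?Y \<in> p" using d(1) P by (auto simp: occurrence_iff)
      ultimately show "d = last ?Y" using inj by (metis inj_onD)
    qed
    moreover have "drop (k - Suc j) ds = last ?Y # ?X"
    proof -
      have "k - j = Suc (k - Suc j)" "k - Suc j < length ds" using Suc.prems len by auto
      then show ?thesis by (simp add: take_Suc_conv_app_nth Cons_nth_drop_Suc)
    qed
    ultimately show ?case by (simp add: IH)
  qed (simp add: len)
  then show ?thesis by (simp add: B_sequence_def len)
qed

section \<open>Reflection in the main diagonal\<close>

text \<open>Swapping coordinates alone would list a chain from right to left; the reversal restores
  the order.\<close>

definition reflect :: "(nat \<times> nat) list \<Rightarrow> (nat \<times> nat) list" where
  "reflect ds = rev (map prod.swap ds)"

lemma reflect_reflect [simp]: "reflect (reflect ds) = ds"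
  by (simp add: reflect_def rev_map)

lemma reflect_simps [simp]:
  "reflect [] = []" "reflect (x # xs) = reflect xs @ [prod.swap x]" "reflect (xs @ ys) = reflect ys @ reflect xs"
  "length (reflect xs) = length xs" "set (reflect xs) = prod.swap ` set xs" "reflect xs = [] \<longleftrightarrow> xs = []"
  by (simp_all add: reflect_def)

lemma reflect_last: "xs \<noteq> [] \<Longrightarrow> last (reflect xs) = prod.swap (hd xs)"
  by (simp add: reflect_def last_rev hd_map)

lemma reflect_hd: "xs \<noteq> [] \<Longrightarrow> hd (reflect xs) = prod.swap (last xs)"
  by (simp add: reflect_def hd_rev last_map)

lemma reflect_eq_iff: "reflect xs = ys \<longleftrightarrow> xs = reflect ys"
  by auto

lemma swap_image_iff: "x \<in> prod.swap ` S \<longleftrightarrow> prod.swap x \<in> S"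
  by (metis image_iff swap_swap)

lemma chain_reflect [simp]: "chain (reflect xs) = chain xs"
  by (induction xs) (auto simp: chain_append chain_Cons reflect_last)

text \<open>The corner is mirrored to the corner because \<open>hd\<close> and \<open>last\<close>
  change places, which requires nonempty lists and hence \<open>k > 0\<close>.\<close>

lemma occurrence_reflect:
  assumes "k > 0"
  shows "occurrence k (prod.swap ` L) (prod.swap ` p) (reflect ds) \<longleftrightarrow> occurrence k L p ds"
proof -
  have "prod.swap ` set ds \<subseteq> prod.swap ` p \<longleftrightarrow> set ds \<subseteq> p"
    by (simp add: inj_image_subset_iff)
  then show ?thesis using assms
    by (cases "ds = []") (auto simp: occurrence_iff reflect_last reflect_hd swap_image_iff)
qed

lemma occurrence_length: "occurrence k L p ds \<Longrightarrow> length ds = k"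
  by (simp add: occurrence_iff)

lemma greedyB_reflect:
  assumes "greedyA k L p ds" "k > 0"
  shows "greedyB k (prod.swap ` L) (prod.swap ` p) (reflect ds)"
  unfolding greedyB_def
proof (intro conjI allI impI; (elim conjE)?)
  show "occurrence k (prod.swap ` L) (prod.swap ` p) (reflect ds)"
    using assms by (simp add: greedyA_def occurrence_reflect)
  fix X Y E assume a: "reflect ds = Y @ X" "Y \<noteq> []" "occurrence k (prod.swap ` L) (prod.swap ` p) (E @ X)"
  have ds: "ds = reflect X @ reflect Y" using a(1) by (simp add: reflect_eq_iff)
  have o: "occurrence k L p (reflect X @ reflect E)"
    using a(3) occurrence_reflect[of k L p "reflect (E @ X)"] assms(2) by simp
  have "E \<noteq> []" using ds a(2) occurrence_length[OF o] assms(1) by (auto simp: greedyA_def dest: occurrence_length)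
  have "snd (hd (reflect Y)) \<le> snd (hd (reflect E))"
    using assms(1) o ds a(2) unfolding greedyA_def by (metis reflect_simps(6))
  then show "fst (last Y) \<le> fst (last E)" using a(2) \<open>E \<noteq> []\<close> by (simp add: reflect_hd)
qed

lemma greedyA_reflect:
  assumes "greedyB k L p ds" "k > 0"
  shows "greedyA k (prod.swap ` L) (prod.swap ` p) (reflect ds)"
  unfolding greedyA_def
proof (intro conjI allI impI; (elim conjE)?)
  show "occurrence k (prod.swap ` L) (prod.swap ` p) (reflect ds)"
    using assms by (simp add: greedyB_def occurrence_reflect)
  fix X Y E assume a: "reflect ds = X @ Y" "Y \<noteq> []" "occurrence k (prod.swap ` L) (prod.swap ` p) (X @ E)"
  have ds: "ds = reflect Y @ reflect X" using a(1) by (simp add: reflect_eq_iff)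
  have o: "occurrence k L p (reflect E @ reflect X)"
    using a(3) occurrence_reflect[of k L p "reflect (X @ E)"] assms(2) by simp
  have "E \<noteq> []" using ds a(2) occurrence_length[OF o] assms(1) by (auto simp: greedyB_def dest: occurrence_length)
  have "fst (last (reflect Y)) \<le> fst (last (reflect E))"
    using assms(1) o ds a(2) unfolding greedyB_def by (metis reflect_simps(6))
  then show "snd (hd Y) \<le> snd (hd E)" using a(2) \<open>E \<noteq> []\<close> by (simp add: reflect_last)
qed

text \<open>The lowest dot that still extends to an occurrence is appended to \<open>X\<close>, and
  the construction recurses. For this the greedy condition is restricted to cuts at or beyond the
  end of \<open>X\<close>.\<close>

lemma greedyA_extension_exists:
  assumes "X @ Y = ds" "occurrence k L p ds"
  shows "\<exists>ds. occurrence k L p ds \<and> (\<exists>Y'. ds = X @ Y') \<and>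
     (\<forall>Z Y E. ds = X @ Z @ Y \<and> Y \<noteq> [] \<and> occurrence k L p (X @ Z @ E) \<longrightarrow> snd (hd Y) \<le> snd (hd E))"
  using assms
proof (induction "length Y" arbitrary: X Y ds)
  case 0
  then show ?case by auto
next
  case (Suc n)
  let ?P = "\<lambda>d. \<exists>E. occurrence k L p (X @ d # E)"
  obtain y Y' where "Y = y # Y'" using Suc(2) by (cases Y) auto
  then have "?P y" using Suc by auto
  define d where "d = (ARG_MIN snd d. ?P d)"
  have "?P d \<and> (\<forall>d'. ?P d' \<longrightarrow> snd d \<le> snd d')"
    unfolding d_def by (rule arg_min_nat_lemma) (rule \<open>?P y\<close>)
  then have d: "?P d" "\<And>d'. ?P d' \<Longrightarrow> snd d \<le> snd d'" by blast+
  from d(1) obtain E where E: "occurrence k L p (X @ d # E)" by auto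
  have "n = length E" using Suc occurrence_length[OF E] occurrence_length[of k L p ds] by auto
  from Suc(1)[OF this, of "X @ [d]"] E obtain es Y'' where es: "occurrence k L p es" "es = X @ d # Y''"
     "\<forall>Z Y E. es = (X @ [d]) @ Z @ Y \<and> Y \<noteq> [] \<and> occurrence k L p ((X @ [d]) @ Z @ E) \<longrightarrow> snd (hd Y) \<le> snd (hd E)"
    by auto
  have "snd (hd Y) \<le> snd (hd E)" if "es = X @ Z @ Y \<and> Y \<noteq> [] \<and> occurrence k L p (X @ Z @ E)" for Z Y E
  proof (cases Z)
    case Nil
    then have "E \<noteq> []" using that occurrence_length[OF es(1)] occurrence_length[of k L p "X @ Z @ E"] by auto
    then have "?P (hd E)" using that Nil by (intro exI[of _ "tl E"]) simp
    from d(2)[OF this] show ?thesis using that es(2) Nil by auto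
  next
    case (Cons z Z')
    then show ?thesis using es(3) that es(2) by auto
  qed
  then show ?case using es(1,2) by blast
qed

lemma greedyA_exists: "contains_pattern k L p \<Longrightarrow> \<exists>ds. greedyA k L p ds"
  using greedyA_extension_exists[of "[]"] unfolding contains_pattern_def greedyA_def by fastforce

lemma greedyB_exists:
  assumes "contains_pattern k L p" "k > 0"
  shows "\<exists>ds. greedyB k L p ds"
proof -
  have "contains_pattern k (prod.swap ` L) (prod.swap ` p)"
    using assms occurrence_reflect unfolding contains_pattern_def by blast
  then obtain ds where "greedyA k (prod.swap ` L) (prod.swap ` p) ds"
    using greedyA_exists by blast
  then show ?thesis using greedyB_reflect assms(2) by (fastforce simp: image_image)
qed

section \<open>The two sequences of a placement\<close>

text \<open>The assumptions are closed under reflection, which exchanges \<open>A\<close> and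
  \<open>B\<close>; each fact about one sequence thus yields its mirror image about the
  other.\<close>

locale crossing =
  fixes k :: nat and L p :: "(nat \<times> nat) set" and A B :: "(nat \<times> nat) list"
  assumes board: "ferrers_board L" and sub: "p \<subseteq> L"
    and inj_fst: "inj_on fst p" and inj_snd: "inj_on snd p" and k_pos: "k > 0"
    and gA: "greedyA k L p A" and gB: "greedyB k L p B"
begin

lemma L_down:
  "(i, j) \<in> L \<Longrightarrow> 1 \<le> i' \<Longrightarrow> i' \<le> i \<Longrightarrow> 1 \<le> j' \<Longrightarrow> j' \<le> j \<Longrightarrow> (i', j') \<in> L"
  using board unfolding ferrers_board_def by blast

lemma p_pos:
  assumes "d \<in> p"
  shows "1 \<le> fst d" "1 \<le> snd d"
  using assms sub board unfolding ferrers_board_def by (cases d; fastforce)+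

lemma eq_fst: "c \<in> p \<Longrightarrow> d \<in> p \<Longrightarrow> fst c = fst d \<Longrightarrow> c = d"
  using inj_fst by (auto dest: inj_onD)

lemma eq_snd: "c \<in> p \<Longrightarrow> d \<in> p \<Longrightarrow> snd c = snd d \<Longrightarrow> c = d"
  using inj_snd by (auto dest: inj_onD)

lemma A_props: "length A = k" "set A \<subseteq> p" "chain A" "A \<noteq> []" "(fst (last A), snd (hd A)) \<in> L"
  using gA k_pos by (auto simp: greedyA_def occurrence_iff)

lemma B_props: "length B = k" "set B \<subseteq> p" "chain B" "B \<noteq> []" "(fst (last B), snd (hd B)) \<in> L"
  using gB k_pos by (auto simp: greedyB_def occurrence_iff)

lemma minA:
  assumes "A = X @ Y" "Y \<noteq> []" "set E \<subseteq> p" "chain (X @ E)" "length E = length Y"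
    and "(fst (last (X @ E)), snd (hd (X @ E))) \<in> L"
  shows "snd (hd Y) \<le> snd (hd E)"
proof -
  have "occurrence k L p (X @ E)" using assms A_props by (auto simp: occurrence_iff)
  then show ?thesis using gA assms unfolding greedyA_def by blast
qed

lemma minB:
  assumes "B = Y @ X" "Y \<noteq> []" "set E \<subseteq> p" "chain (E @ X)" "length E = length Y"
    and "(fst (last (E @ X)), snd (hd (E @ X))) \<in> L"
  shows "fst (last Y) \<le> fst (last E)"
proof -
  have "occurrence k L p (E @ X)" using assms B_props by (auto simp: occurrence_iff)
  then show ?thesis using gB assms unfolding greedyB_def by blast
qed

lemma crossing_reflect: "crossing k (prod.swap ` L) (prod.swap ` p) (reflect B) (reflect A)"
proof
  show "ferrers_board (prod.swap ` L)"
    using board unfolding ferrers_board_def by (auto simp: swap_image_iff)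
  show "prod.swap ` p \<subseteq> prod.swap ` L" using sub by blast
  show "inj_on fst (prod.swap ` p)" "inj_on snd (prod.swap ` p)"
    using inj_fst inj_snd by (auto simp: inj_on_def)
  show "greedyA k (prod.swap ` L) (prod.swap ` p) (reflect B)" using greedyA_reflect gB k_pos .
  show "greedyB k (prod.swap ` L) (prod.swap ` p) (reflect A)" using greedyB_reflect gA k_pos .
qed (rule k_pos)

text \<open>Each sequence is an occurrence that competes with the other one before any dot is
  fixed.\<close>

lemma cross: "snd (hd A) \<le> snd (hd B)" "fst (last B) \<le> fst (last A)"
  using minA[of "[]" A B] minB[of B "[]" A] A_props B_props by auto

section \<open>Length of chains under the corners of \<open>A\<close> and \<open>B\<close>\<close>

lemma cornerA:
  assumes "1 \<le> i" "i \<le> fst (last A)" "1 \<le> j" "j \<le> snd (hd A)"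
  shows "(i, j) \<in> L"
  using L_down[OF A_props(5)] assms by blast

text \<open>Dropping dots from the front of a longer chain until \<open>k\<close> remain leaves an
  occurrence that starts strictly lower than \<open>A\<close>; its corner is on the board, being
  dominated by the corner of \<open>A\<close>.\<close>

lemma length_le_A:
  assumes "chain E" "set E \<subseteq> p" "snd (hd E) \<le> snd (hd A)" "fst (last E) \<le> fst (last A)"
  shows "length E \<le> k"
proof (rule ccontr)
  assume "\<not> length E \<le> k"
  then obtain n where n: "length E = Suc n + k"
    by (metis add.commute add_Suc_right less_imp_Suc_add not_le)
  let ?E = "drop (Suc n) E"
  have ne: "E \<noteq> []" "?E \<noteq> []" using n k_pos by auto
  have lt: "snd (hd ?E) < snd (hd E)"
    using chain_nth[OF assms(1), of 0 "Suc n"] n k_pos ne by (simp add: hd_drop_conv_nth hd_conv_nth)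
  have in_p: "hd ?E \<in> p" "last E \<in> p"
    using hd_in_set[OF ne(2)] last_in_set[OF ne(1)] assms(2) by (auto dest: in_set_dropD)
  have "snd (hd A) \<le> snd (hd ?E)"
  proof (rule minA[of "[]"])
    show "set ?E \<subseteq> p" using assms(2) set_drop_subset by fast
    have "last ?E = last E" using ne(2) by (simp add: last_drop)
    then show "(fst (last ([] @ ?E)), snd (hd ([] @ ?E))) \<in> L"
      using cornerA p_pos in_p assms lt by simp
  qed (use A_props n assms chain_drop in auto)
  then show False using lt assms(3) by simp
qed

lemma length_le_B:
  assumes "chain E" "set E \<subseteq> p" "snd (hd E) \<le> snd (hd B)" "fst (last E) \<le> fst (last B)"
  shows "length E \<le> k"
proof (cases "E = []")
  case False
  then have "length (reflect E) \<le> k"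
    using assms B_props(4) by (intro crossing.length_le_A[OF crossing_reflect]) (auto simp: reflect_last reflect_hd)
  then show ?thesis by simp
qed simp

text \<open>A chain dropping below \<open>B\<close> is pushed back onto \<open>B\<close> up to the first index at which it is
  to the right of \<open>B\<close> again; before that index it stays below \<open>B\<close>, as otherwise \<open>B\<close> could be
  moved to the left.\<close>

lemma repair:
  assumes "B = X @ b # Y" "chain (P @ F)" "set (P @ F) \<subseteq> p" "length P = length X"
    and "P \<noteq> []" "hd P = hd B" "F \<noteq> []" "fst (hd F) < fst b"
  shows "\<exists>l. 1 \<le> l \<and> l \<le> length F \<and> l \<le> length Y \<and> chain (b # take l Y @ drop l F) \<and>
    (\<forall>i<l. fst (F ! i) < fst ((b # Y) ! i) \<and> snd (F ! i) < snd (Y ! i))"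
  using assms
proof (induction Y arbitrary: X b P F)
  case Nil
  obtain x F' where F: "F = x # F'" using Nil.prems(7) by (cases F) auto
  have "x \<in> p" "hd B \<in> p" using Nil.prems F B_props(2) hd_in_set[OF B_props(4)] by auto
  \<comment> \<open>No dot of \<open>B\<close> follows \<open>b\<close>, so \<open>P @ [x]\<close>
    would be an occurrence ending left of \<open>B\<close>; the shared \<open>hd B\<close> keeps its
    corner on the board.\<close>
  have "fst (last B) \<le> fst (last (P @ [x]))"
  proof (rule minB[of B "[]"])
    show "(fst (last ((P @ [x]) @ [])), snd (hd ((P @ [x]) @ []))) \<in> L"
      using L_down[OF B_props(5)] Nil.prems F p_pos[OF \<open>x \<in> p\<close>] p_pos[OF \<open>hd B \<in> p\<close>] by simp
  qed (use Nil.prems F B_props in \<open>auto simp: chain_append chain_Cons\<close>)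
  then show ?case using Nil.prems F by simp
next
  case (Cons b' Y)
  obtain x F' where F: "F = x # F'" using Cons.prems(7) by (cases F) auto
  have in_p: "x \<in> p" "b \<in> p" "b' \<in> p" "set F' \<subseteq> p" using Cons.prems F B_props(2) by auto
  have cB: "chain (b # b' # Y)" using B_props(3) Cons.prems(1) by (auto simp: chain_append)
  have xb: "fst x < fst b" using Cons.prems F by simp
  \<comment> \<open>Otherwise \<open>b' # Y\<close> could follow \<open>x\<close>, and
    \<open>x\<close> would take the place of \<open>b\<close> further left.\<close>
  have below: "snd x < snd b'"
  proof (rule ccontr)
    assume "\<not> snd x < snd b'"
    moreover have "snd x \<noteq> snd b'" using eq_snd[OF in_p(1,3)] xb cB by (auto simp: chain_Cons)
    ultimately have "snd b' < snd x" by simp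
    then have c: "chain ((P @ [x]) @ b' # Y)"
      using Cons.prems F cB xb by (auto simp: chain_append chain_Cons)
    have "fst (last (X @ [b])) \<le> fst (last (P @ [x]))"
      by (rule minB[of _ "b' # Y"]) (use Cons.prems F B_props c in auto)
    then show False using xb by simp
  qed
  show ?case
  proof (cases "F' = [] \<or> fst b' < fst (hd F')")
    case True
    then have "chain (b # take 1 (b' # Y) @ drop 1 F)"
      using Cons.prems F cB below by (auto simp: chain_append chain_Cons)
    then show ?thesis using xb below F by (intro exI[of _ 1]) auto
  next
    case False
    have "hd F' \<in> p" using False in_p(4) by (cases F') auto
    have "snd (hd F') < snd x" using False Cons.prems F by (auto simp: chain_append chain_Cons)
    then have "fst (hd F') \<noteq> fst b'" using eq_fst[OF \<open>hd F' \<in> p\<close> in_p(3)] below by auto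
    then have "fst (hd F') < fst b'" using False by simp
    then obtain l where l: "1 \<le> l" "l \<le> length F'" "l \<le> length Y" "chain (b' # take l Y @ drop l F')"
      "\<forall>i<l. fst (F' ! i) < fst ((b' # Y) ! i) \<and> snd (F' ! i) < snd (Y ! i)"
      using Cons.IH[of "X @ [b]" b' "P @ [x]" F'] Cons.prems F False by auto
    have "chain (b # take (Suc l) (b' # Y) @ drop (Suc l) F)"
      using l(4) cB F by (simp add: chain_Cons)
    moreover have "fst (F ! i) < fst ((b # b' # Y) ! i) \<and> snd (F ! i) < snd ((b' # Y) ! i)"
      if "i < Suc l" for i
      using that l(5) F xb below by (cases i) auto
    ultimately show ?thesis using l F by (intro exI[of _ "Suc l"]) auto
  qed
qed

lemma last_repaired:
  assumes "B = X @ b # Y" "l \<le> length F" "F \<noteq> []"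
  shows "fst (last (b # take l Y @ drop l F)) \<le> max (fst (last F)) (fst (last B))"
proof (cases "l < length F")
  case True
  then have "last (b # take l Y @ drop l F) = last F" by (simp add: last_drop)
  then show ?thesis by simp
next
  case False
  then have "b # take l Y @ drop l F = b # take l Y" by simp
  then have "last (b # take l Y @ drop l F) \<in> set (b # take l Y)" by (metis last_in_set list.distinct(1))
  then have "last (b # take l Y @ drop l F) \<in> set B" using assms(1) by (auto dest: in_set_takeD)
  then show ?thesis using chain_bounds(2)[OF B_props(3)] by (metis max.coboundedI2)
qed

text \<open>\<open>shift_core\<close> is the B-shift of \<open>p\<close> without the dot that receives the top row of \<open>B\<close>.\<close>

definition shift_core where "shift_core = (p - set B) \<union> set (links B)"

text \<open>From right to left, each link \<open>(fst b', snd b)\<close> is replaced by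
  \<open>b\<close>, in the same row. If the chain built so far starts left of \<open>b\<close>,
  \<open>repair\<close> pushes it onto \<open>B\<close>. Length and top row survive, and the last
  column grows at most to that of \<open>B\<close>.\<close>

lemma transport:
  assumes "chain E" "set E \<subseteq> shift_core" "E \<noteq> []"
  shows "\<exists>F. chain F \<and> set F \<subseteq> p \<and> length F = length E \<and> snd (hd F) = snd (hd E) \<and>
    fst (hd E) \<le> fst (hd F) \<and> fst (last F) \<le> max (fst (last E)) (fst (last B))"
  using assms
proof (induction E)
  case (Cons e E)
  have e: "e \<in> p \<or> (\<exists>X b' b Y. B = X @ b' # b # Y \<and> e = (fst b', snd b))"
  proof (cases "e \<in> p")
    case False
    then have "e \<in> set (links B)" using Cons.prems(2) by (auto simp: shift_core_def)
    then show ?thesis by (metis in_linksE)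
  qed simp
  show ?case
  proof (cases "E = []")
    case True
    show ?thesis
    proof (cases "e \<in> p")
      case True then show ?thesis using \<open>E = []\<close> by (intro exI[of _ "[e]"]) (auto simp: chain_Cons)
    next
      case False
      then obtain X b' b Y where b: "B = X @ b' # b # Y" "e = (fst b', snd b)" using e by blast
      have "fst b' < fst b" "fst b \<le> fst (last B)" "b \<in> p"
        using b B_props chain_bounds(2)[OF B_props(3), of b] by (auto simp: chain_append chain_Cons)
      then show ?thesis using \<open>E = []\<close> b by (intro exI[of _ "[b]"]) (auto simp: chain_Cons)
    qed
  next
    case False
    then obtain F where F: "chain F" "set F \<subseteq> p" "length F = length E" "snd (hd F) = snd (hd E)"
      "fst (hd E) \<le> fst (hd F)" "fst (last F) \<le> max (fst (last E)) (fst (last B))"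
      using Cons by (auto simp: chain_Cons)
    have ne: "F \<noteq> []" using F(3) False by auto
    have eE: "fst e < fst (hd E)" "snd (hd E) < snd e" using Cons.prems(1) False by (auto simp: chain_Cons)
    show ?thesis
    proof (cases "e \<in> p")
      case True
      then show ?thesis using F False ne eE by (intro exI[of _ "e # F"]) (auto simp: chain_Cons)
    next
      case False
      then obtain X b' b Y where b: "B = X @ b' # b # Y" "e = (fst b', snd b)" using e by blast
      have bb: "fst b' < fst b" "snd b < snd b'" "fst b \<le> fst (last B)" "b \<in> p"
        using b B_props chain_bounds(2)[OF B_props(3), of b] by (auto simp: chain_append chain_Cons)
      have hF: "hd F \<in> p" using ne F by auto
      show ?thesis
      proof (cases "fst b < fst (hd F)")
        case True
        then show ?thesis using F ne eE b bb \<open>E \<noteq> []\<close>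
          by (intro exI[of _ "b # F"]) (auto simp: chain_Cons)
      next
        case False
        have "fst (hd F) \<noteq> fst b" using eq_fst[OF hF bb(4)] F(4) eE b by auto
        then have lt: "fst (hd F) < fst b" using False by simp
        \<comment> \<open>The part of \<open>B\<close> before \<open>b\<close> is the prefix for
          \<open>repair\<close>; \<open>F\<close> can follow it because \<open>b'\<close> lies above
          \<open>e\<close> in the same column.\<close>
        have "chain ((X @ [b']) @ F)"
          using B_props(3) b F eE ne bb by (auto simp: chain_append chain_Cons)
        moreover have "hd (X @ [b']) = hd B" using b(1) by (cases X) auto
        ultimately obtain l where l: "l \<le> length F" "l \<le> length Y" "chain (b # take l Y @ drop l F)"
          using repair[of "X @ [b']" b Y "X @ [b']" F] b B_props(2) F(2) lt ne
          by auto
        have "fst (last (b # take l Y @ drop l F)) \<le> max (fst (last F)) (fst (last B))"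
          using last_repaired[of "X @ [b']" b Y] b l ne by simp
        moreover have "set (take l Y) \<subseteq> p" "set (drop l F) \<subseteq> p"
          using b B_props(2) F(2) by (auto dest: in_set_takeD in_set_dropD)
        ultimately show ?thesis using F b bb l \<open>E \<noteq> []\<close>
          by (intro exI[of _ "b # take l Y @ drop l F"]) auto
      qed
    qed
  qed
qed simp

section \<open>Order of \<open>A\<close> and \<open>B\<close> around common dots\<close>

text \<open>If \<open>a\<close> were lower than \<open>b\<close>, a chain of \<open>k + 1\<close>
  dots would fit under the corner of \<open>A\<close>: either \<open>b\<close> can be inserted
  between \<open>c\<close> and \<open>a\<close>, or \<open>a\<close> lies left of \<open>b\<close>
  and \<open>repair\<close> yields a tail through \<open>b\<close> that is one dot longer than
  \<open>a # A2\<close>.\<close>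

lemma exit_order:
  assumes "A = A1 @ c # a # A2" "B = B1 @ c # b # B2"
  shows "snd b \<le> snd a"
proof (rule ccontr)
  assume "\<not> snd b \<le> snd a"
  then have lt: "snd a < snd b" by simp
  have in_p: "a \<in> p" "b \<in> p" "set A1 \<subseteq> p" "set A2 \<subseteq> p" "set B1 \<subseteq> p" "set B2 \<subseteq> p" "c \<in> p"
    using assms A_props(2) B_props(2) by auto
  have cA: "chain (A1 @ c # a # A2)" and cB: "chain (B1 @ c # b # B2)" using assms A_props B_props by simp_all
  have "fst a \<noteq> fst b" using eq_fst[OF in_p(1,2)] lt by auto
  then consider "fst b < fst a" | "fst a < fst b" by linarith
  then show False
  proof cases
    case 1
    let ?E = "A1 @ c # b # a # A2"
    have "chain ?E" using cA cB 1 lt by (auto simp: chain_append chain_Cons)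
    moreover have "hd ?E = hd A" "last ?E = last A" using assms(1) by (cases A1; simp)+
    ultimately have "length ?E \<le> k" using in_p by (intro length_le_A) auto
    then show False using A_props(1) assms(1) by simp
  next
    case 2
    have "chain ((B1 @ [c]) @ a # A2)" using cA cB by (auto simp: chain_append chain_Cons)
    moreover have "hd (B1 @ [c]) = hd B" using assms(2) by (cases B1) auto
    ultimately obtain l where l: "l \<le> length (a # A2)" "l \<le> length B2" "chain (b # take l B2 @ drop l (a # A2))"
      using repair[of "B1 @ [c]" b B2 "B1 @ [c]" "a # A2"] assms in_p 2 by auto
    let ?G = "b # take l B2 @ drop l (a # A2)"
    have "fst (last ?G) \<le> max (fst (last (a # A2))) (fst (last B))"
      using assms l by (intro last_repaired[of "B1 @ [c]" b B2]) auto
    moreover have "last A = last (a # A2)" using assms by simp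
    ultimately have last: "fst (last ?G) \<le> fst (last A)" using cross by simp
    have "length (A1 @ c # ?G) \<le> k"
    proof (rule length_le_A)
      show "chain (A1 @ c # ?G)" using l(3) cA cB by (auto simp: chain_append chain_Cons)
      show "set (A1 @ c # ?G) \<subseteq> p" using in_p by (auto dest!: in_set_takeD in_set_dropD)
      have "hd (A1 @ c # ?G) = hd A" using assms by (cases A1) auto
      then show "snd (hd (A1 @ c # ?G)) \<le> snd (hd A)" by simp
      show "fst (last (A1 @ c # ?G)) \<le> fst (last A)" using last by simp
    qed
    then show False using A_props(1) assms(1) l by simp
  qed
qed

lemma enter_order:
  assumes "A = A1 @ a # c # A2" "B = B1 @ b # c # B2"
  shows "fst a \<le> fst b"
  using crossing.exit_order[OF crossing_reflect, of "reflect B2" "prod.swap c" "prod.swap b" "reflect B1"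
      "reflect A2" "prod.swap a" "reflect A1"] assms by simp

text \<open>Opposite inequalities fix each dot in turn: greediness of \<open>A\<close> against the
  exchanged occurrence, and \<open>exit_order\<close> at the preceding common dot.\<close>

lemma common_middle:
  assumes "A = A1 @ c # M @ R" "B = B1 @ c # N @ S" "length M = length N"
    and "occurrence k L p (A1 @ c # N @ R)"
  shows "M = N"
  using assms
proof (induction M arbitrary: A1 c B1 N)
  case (Cons a M)
  then obtain b N' where N: "N = b # N'" by (cases N) auto
  have "snd (hd ((a # M) @ R)) \<le> snd (hd (N @ R))"
    using Cons.prems by (intro minA[of "A1 @ [c]"]) (auto simp: occurrence_iff)
  moreover have "snd b \<le> snd a" using exit_order Cons.prems N by simp
  ultimately have "a = b" using Cons.prems N A_props(2) B_props(2) by (auto intro!: eq_snd)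
  then show ?case using Cons.IH[of "A1 @ [c]" a "B1 @ [c]" N'] Cons.prems N by simp
qed simp

text \<open>The part of \<open>A\<close> up to \<open>c\<close> continued by \<open>B2\<close> stays
  under the corner of \<open>A\<close>, since \<open>B\<close> ends no further right than
  \<open>A\<close>.\<close>

lemma common_tail_length:
  assumes "A = A1 @ c # A2" "B = B1 @ c # B2"
  shows "length B2 \<le> length A2"
proof -
  have "length (A1 @ c # B2) \<le> k"
  proof (rule length_le_A)
    show "chain (A1 @ c # B2)" "set (A1 @ c # B2) \<subseteq> p"
      using A_props(2,3) B_props(2,3) assms by (auto simp: chain_append chain_Cons)
    have "hd (A1 @ c # B2) = hd A" using assms(1) by (cases A1) auto
    then show "snd (hd (A1 @ c # B2)) \<le> snd (hd A)" by simp
    have "last (A1 @ c # B2) = last B" using assms(2) by simp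
    then show "fst (last (A1 @ c # B2)) \<le> fst (last A)" using cross by simp
  qed
  then show ?thesis using A_props(1) assms(1) by simp
qed

lemma common_tail:
  assumes "A = A1 @ c # A2" "B = B1 @ c # B2" "length A2 = length B2"
  shows "A2 = B2"
proof (rule common_middle[of A1 c A2 "[]" B1 B2 "[]"])
  have "hd (A1 @ c # B2) = hd A" using assms(1) by (cases A1) auto
  moreover have "last (A1 @ c # B2) = last B" using assms(2) by simp
  moreover have "1 \<le> fst (last B)" "1 \<le> snd (hd A)"
    using p_pos(1)[of "last B"] p_pos(2)[of "hd A"] last_in_set[OF B_props(4)] hd_in_set[OF A_props(4)] A_props(2) B_props(2)
    by blast+
  ultimately have "(fst (last (A1 @ c # B2)), snd (hd (A1 @ c # B2))) \<in> L"
    using cornerA cross by simp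
  then show "occurrence k L p (A1 @ c # B2 @ [])"
    using A_props B_props assms by (auto simp: occurrence_iff chain_append chain_Cons)
qed (use assms in auto)

lemma common_head:
  assumes "A = A1 @ c # A2" "B = B1 @ c # B2" "length A1 = length B1"
  shows "A1 = B1"
proof -
  have "reflect B1 = reflect A1"
    by (rule crossing.common_tail[OF crossing_reflect, of "reflect B2" "prod.swap c" _ "reflect A2"]) (use assms in auto)
  then show ?thesis by (metis reflect_reflect)
qed

text \<open>Take the first and the last common dot. Exchanging the stretches between them gives
  chains with the ends of \<open>A\<close> and of \<open>B\<close>; the two length bounds force the
  stretches to be equally long, and \<open>common_middle\<close> makes them equal.\<close>

lemma common_segment:
  assumes "set A \<inter> set B \<noteq> {}"
  obtains A1 C A2 B1 B2 where "A = A1 @ C @ A2" "B = B1 @ C @ B2" "C \<noteq> []"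
    "set A1 \<inter> set B = {}" "set A2 \<inter> set B = {}"
proof -
  obtain A1 c R where A1: "A = A1 @ c # R" "c \<in> set B" "\<forall>y \<in> set A1. y \<notin> set B"
    using split_list_first_prop[of A "\<lambda>x. x \<in> set B"] assms by blast
  obtain B1 T where B1: "B = B1 @ c # T" using A1(2) by (meson split_list)
  show ?thesis
  proof (cases "set R \<inter> set B = {}")
    case True
    show ?thesis by (rule that[of A1 "[c]" R B1 T]) (use A1 B1 True in auto)
  next
    case False
    then obtain M c' A2 where R: "R = M @ c' # A2" "c' \<in> set B" "\<forall>y \<in> set A2. y \<notin> set B"
      using split_list_last_prop[of R "\<lambda>x. x \<in> set B"] by blast
    have "fst c < fst c'" using A_props(3) A1(1) R(1) by (auto simp: chain_def sorted_wrt_append)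
    moreover have "\<forall>x \<in> set B1. fst x < fst c"
      using B_props(3) unfolding B1 chain_def sorted_wrt_append by auto
    ultimately have "c' \<notin> insert c (set B1)" by auto
    then have "c' \<in> set T" using R(2) unfolding B1 by simp
    then obtain N B2 where T: "T = N @ c' # B2" by (meson split_list)
    have eqs: "A = A1 @ c # M @ c' # A2" "B = B1 @ c # N @ c' # B2" using A1 B1 R T by simp_all
    have "chain (A1 @ [c])" "chain (c # M @ [c'])" "chain (c' # A2)"
      using A_props(3) chain_glue[of A1 c "M @ c' # A2"] chain_glue[of "c # M" c' A2] unfolding eqs by simp_all
    moreover have "chain (B1 @ [c])" "chain (c # N @ [c'])" "chain (c' # B2)"
      using B_props(3) chain_glue[of B1 c "N @ c' # B2"] chain_glue[of "c # N" c' B2] unfolding eqs by simp_all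
    ultimately have ch: "chain (A1 @ c # N @ c' # A2)" "chain (B1 @ c # M @ c' # B2)"
      using chain_glue[of A1 c "N @ c' # A2"] chain_glue[of "c # N" c' A2]
        chain_glue[of B1 c "M @ c' # B2"] chain_glue[of "c # M" c' B2] by simp_all
    have sub_p: "set (A1 @ c # N @ c' # A2) \<subseteq> p" "set (B1 @ c # M @ c' # B2) \<subseteq> p"
      using A_props(2) B_props(2) unfolding eqs by simp_all
    note cN = ch(1) sub_p(1) and cM = ch(2) sub_p(2)
    have hN: "hd (A1 @ c # N @ c' # A2) = hd A" "last (A1 @ c # N @ c' # A2) = last A"
      and hM: "hd (B1 @ c # M @ c' # B2) = hd B" "last (B1 @ c # M @ c' # B2) = last B"
      unfolding eqs by (simp_all add: hd_append)
    have "length (A1 @ c # N @ c' # A2) \<le> k" "length (B1 @ c # M @ c' # B2) \<le> k"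
      using length_le_A[OF cN] length_le_B[OF cM] hN hM by simp_all
    then have len: "length M = length N" using A_props(1) B_props(1) eqs by simp
    then have "occurrence k L p (A1 @ c # N @ c' # A2)"
      using cN hN A_props(1,5) eqs(1) by (simp add: occurrence_iff)
    then have "M = N" using common_middle[OF eqs(1)] eqs(2) len by simp
    then show ?thesis
      by (intro that[of A1 "c # M @ [c']" A2 B1 B2]) (use A1 R eqs in auto)
  qed
qed

section \<open>Greediness of \<open>A\<close> after the B-shift\<close>

lemma B_shift_cases:
  "e \<in> cyclic_shift p B \<longleftrightarrow> e \<in> shift_core \<or> e = (fst (last B), snd (hd B))"
  using cyclic_shift_eq[OF B_props(4)] by (auto simp: shift_core_def)

text \<open>A chain starting lower than \<open>Y\<close> would be carried back into \<open>p\<close>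
  behind the same prefix \<open>X\<close>. The corner stays on the board because the carried chain
  ends no further right than \<open>E\<close> or than \<open>A\<close>.\<close>

lemma minA_transport:
  assumes "A = X @ Y" "Y \<noteq> []" "chain E" "set E \<subseteq> shift_core" "length E = length Y"
    and "X \<noteq> [] \<Longrightarrow> fst (last X) < fst (hd E) \<and> snd (hd E) < snd (last X)"
    and "(fst (last E), snd (hd (X @ E))) \<in> L"
  shows "snd (hd Y) \<le> snd (hd E)"
proof (rule ccontr)
  assume "\<not> snd (hd Y) \<le> snd (hd E)"
  then have lt: "snd (hd E) < snd (hd Y)" by simp
  have "E \<noteq> []" using assms(2,5) by auto
  then obtain F where F: "chain F" "set F \<subseteq> p" "length F = length E" "snd (hd F) = snd (hd E)"
    "fst (hd E) \<le> fst (hd F)" "fst (last F) \<le> max (fst (last E)) (fst (last B))"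
    using transport assms by blast
  have ne: "F \<noteq> []" using F(3) \<open>E \<noteq> []\<close> by auto
  have "chain (X @ F)"
    using F ne assms A_props(3) by (cases "X = []") (auto simp: chain_append)
  moreover have "(fst (last (X @ F)), snd (hd (X @ F))) \<in> L"
  proof -
    have top: "snd (hd (X @ F)) = snd (hd (X @ E))" using F(4) by (cases X) auto
    have le: "snd (hd (X @ F)) \<le> snd (hd A)" using assms(1) lt F(4) by (cases X) auto
    have "last F \<in> p" using ne F(2) by auto
    moreover have "hd (X @ F) \<in> p"
      using ne F(2) A_props(2) assms(1) by (cases X) auto
    ultimately have pos: "1 \<le> fst (last F)" "1 \<le> snd (hd (X @ F))" using p_pos by blast+
    show ?thesis
    proof (cases "fst (last F) \<le> fst (last E)")
      case True
      then show ?thesis using L_down[OF assms(7)] pos top ne by simp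
    next
      case False
      then have "fst (last F) \<le> fst (last A)" using F(6) cross by auto
      then show ?thesis using cornerA pos le ne by simp
    qed
  qed
  ultimately have "snd (hd Y) \<le> snd (hd F)"
    using minA[OF assms(1,2) F(2)] F(3) assms(5) by simp
  then show False using lt F(4) by simp
qed

text \<open>The only dot of the B-shift that can be missing from \<open>shift_core\<close> lies in
  the top row of \<open>B\<close>.\<close>

lemma below_B_in_shift_core:
  assumes "chain E" "set E \<subseteq> cyclic_shift p B" "snd (hd E) < snd (hd B)"
  shows "set E \<subseteq> shift_core"
proof
  fix e assume "e \<in> set E"
  then have "snd e < snd (hd B)" using chain_bounds(4)[OF assms(1)] assms(3) by fastforce
  then show "e \<in> shift_core" using subsetD[OF assms(2) \<open>e \<in> set E\<close>] B_shift_cases[of e] by auto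
qed

lemma greedyA_B_shift_disjoint:
  assumes "set A \<inter> set B = {}"
  shows "greedyA k L (cyclic_shift p B) A"
  unfolding greedyA_def
proof (intro conjI allI impI; (elim conjE)?)
  show "occurrence k L (cyclic_shift p B) A"
    using A_props assms by (auto simp: occurrence_iff B_shift_cases shift_core_def)
  fix X Y E assume a: "A = X @ Y" "Y \<noteq> []" "occurrence k L (cyclic_shift p B) (X @ E)"
  have len: "length E = length Y" using a A_props(1) by (auto simp: occurrence_iff)
  have ne: "E \<noteq> []" using len a(2) by auto
  have E: "chain E" "set E \<subseteq> cyclic_shift p B" using a(3) by (auto simp: occurrence_iff chain_append)
  show "snd (hd Y) \<le> snd (hd E)"
  proof (rule ccontr)
    assume n: "\<not> snd (hd Y) \<le> snd (hd E)"
    have "hd Y \<in> set A" using a(1,2) by auto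
    then have "snd (hd Y) \<le> snd (hd B)" using chain_bounds(4)[OF A_props(3)] cross(1) by fastforce
    then have "set E \<subseteq> shift_core" using below_B_in_shift_core[OF E] n by simp
    then have "snd (hd Y) \<le> snd (hd E)"
      using a E len ne by (intro minA_transport[of X]) (auto simp: occurrence_iff chain_append)
    then show False using n by simp
  qed
qed

end

section \<open>The common segment of \<open>A\<close> and \<open>B\<close>\<close>

locale crossing_segment = crossing +
  fixes A1 C A2 B1 B2 :: "(nat \<times> nat) list"
  assumes A_eq: "A = A1 @ C @ A2" and B_eq: "B = B1 @ C @ B2" and C_ne: "C \<noteq> []"
    and A2_ne: "A2 \<noteq> []" and B1_ne: "B1 \<noteq> []"
    and A1_B: "set A1 \<inter> set B = {}" and A2_B: "set A2 \<inter> set B = {}"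
    and B1_A: "set B1 \<inter> set A = {}" and B2_A: "set B2 \<inter> set A = {}"

context crossing
begin

text \<open>\<open>B2\<close> is at most as long as \<open>A2\<close>. Equal lengths would make
  tails and heads agree, hence \<open>A = B\<close>. So \<open>A2\<close> is nonempty, and as both
  sequences have \<open>k\<close> dots, \<open>B1\<close> is longer than \<open>A1\<close> and
  nonempty as well; \<open>A1\<close> and \<open>B2\<close> may be empty.\<close>

lemma crossing_segment_exists:
  assumes "set A \<inter> set B \<noteq> {}" "A \<noteq> B"
  shows "\<exists>A1 C A2 B1 B2. crossing_segment k L p A B A1 C A2 B1 B2"
proof -
  obtain A1 C A2 B1 B2 where C: "A = A1 @ C @ A2" "B = B1 @ C @ B2" "C \<noteq> []"
    "set A1 \<inter> set B = {}" "set A2 \<inter> set B = {}"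
    using common_segment[OF assms(1)] .
  have C': "C = butlast C @ [last C]" "C = hd C # tl C" using C(3) by simp_all
  have setC: "set C = insert (hd C) (set (tl C))" "set C = insert (last C) (set (butlast C))"
    by (metis C'(2) list.simps(15)) (metis C'(1) Un_insert_right append_Nil2 list.simps(15) set_append sup_bot.right_neutral empty_set)
  have eqs: "A = (A1 @ butlast C) @ last C # A2" "B = (B1 @ butlast C) @ last C # B2"
    using C(1,2) C'(1) by (metis append.assoc append_Cons append_Nil)+
  have eqs': "A = A1 @ hd C # tl C @ A2" "B = B1 @ hd C # tl C @ B2"
    using C(1,2) C'(2) by (metis append_Cons)+
  have le: "length B2 \<le> length A2" using common_tail_length[OF eqs] .
  have ne: "length B2 < length A2"
  proof (rule ccontr)
    assume "\<not> length B2 < length A2"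
    then have "length A2 = length B2" using le by simp
    moreover from this have "length A1 = length B1" using C(1,2) A_props(1) B_props(1) by simp
    ultimately show False
      using common_tail[OF eqs] common_head[OF eqs'] C(1,2) assms(2) by simp
  qed
  have "A2 \<noteq> []" "B1 \<noteq> []" using ne C(1,2) A_props(1) B_props(1) by auto
  moreover have "x \<notin> set A" if "x \<in> set B1" for x
  proof
    assume "x \<in> set A"
    then have "x \<in> set (C @ A2)" using that C by auto
    then have "x \<in> insert (hd C) (set (tl C @ A2))" using setC(1) by auto
    moreover have "\<forall>y \<in> set (tl C @ A2). fst (hd C) < fst y"
      using A_props(3) unfolding eqs' by (simp add: chain_def sorted_wrt_append)
    ultimately have "x = hd C \<or> fst (hd C) < fst x" by blast
    then show False using B_props(3) that unfolding eqs' by (auto simp: chain_def sorted_wrt_append)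
  qed
  moreover have "x \<notin> set A" if "x \<in> set B2" for x
  proof
    assume "x \<in> set A"
    then have "x \<in> set (A1 @ C)" using that C by auto
    then have "x \<in> insert (last C) (set (A1 @ butlast C))" using setC(2) by auto
    moreover have "\<forall>y \<in> set (A1 @ butlast C). fst y < fst (last C)"
      using A_props(3) unfolding eqs chain_def sorted_wrt_append by auto
    ultimately have "x = last C \<or> fst x < fst (last C)" by blast
    then show False using B_props(3) that unfolding eqs by (auto simp: chain_def sorted_wrt_append)
  qed
  ultimately have "crossing_segment k L p A B A1 C A2 B1 B2"
    using C by unfold_locales auto
  then show ?thesis by blast
qed

end

context crossing_segment
begin

lemma crossing_segment_reflect:
  "crossing_segment k (prod.swap ` L) (prod.swap ` p) (reflect B) (reflect A)
     (reflect B2) (reflect C) (reflect B1) (reflect A2) (reflect A1)"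
proof -
  interpret R: crossing k "prod.swap ` L" "prod.swap ` p" "reflect B" "reflect A" by (rule crossing_reflect)
  show ?thesis
    using C_ne A2_ne B1_ne A1_B A2_B B1_A B2_A
    by unfold_locales (auto simp: A_eq B_eq)
qed

end

section \<open>The A-sequence of the B-shift\<close>

text \<open>The dots in the open rectangle between \<open>u\<close> and \<open>w\<close>; they are the same for both shifts.\<close>

definition inner ::
    "nat \<times> nat \<Rightarrow> nat \<times> nat \<Rightarrow> (nat \<times> nat) list \<Rightarrow> (nat \<times> nat) set \<Rightarrow> (nat \<times> nat) set" where
  "inner u w C p = {z \<in> p - set C. fst u < fst z \<and> fst z < fst (last C) \<and>
     snd w < snd z \<and> snd z < snd (hd C)} \<union> set (links C)"

context crossing_segment
begin

abbreviation "u \<equiv> last B1"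
abbreviation "w \<equiv> hd A2"
abbreviation "u' \<equiv> (fst (last B1), snd (hd C))"
abbreviation "Q \<equiv> inner u w C p"

lemma chains: "chain A1" "chain A2" "chain B1" "chain B2" "chain C"
  using A_props(3) B_props(3) by (simp_all add: A_eq B_eq chain_append)

lemma in_p: "set A1 \<subseteq> p" "set A2 \<subseteq> p" "set B1 \<subseteq> p" "set B2 \<subseteq> p" "set C \<subseteq> p"
  using A_props(2) B_props(2) by (simp_all add: A_eq B_eq)

lemma around_C: "fst u < fst (hd C)" "snd (hd C) < snd u" "fst (last C) < fst w" "snd w < snd (last C)"
  using A_props(3) B_props(3) C_ne A2_ne B1_ne by (simp_all add: A_eq B_eq chain_append)

text \<open>Needed so that \<open>u'\<close>, which enters the rectangle further left than
  \<open>hd C\<close>, can still follow \<open>A1\<close>.\<close>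

lemma last_A1: "A1 \<noteq> [] \<Longrightarrow> fst (last A1) < fst u \<and> snd (hd C) < snd (last A1)"
proof
  assume ne: "A1 \<noteq> []"
  have "A = butlast A1 @ last A1 # hd C # tl C @ A2" "B = butlast B1 @ u # hd C # tl C @ B2"
    using ne B1_ne C_ne by (simp_all add: A_eq B_eq)
  then have "fst (last A1) \<le> fst u" by (rule enter_order)
  moreover have "last A1 \<in> set A1" "u \<in> set B1" using ne B1_ne by simp_all
  then have "last A1 \<noteq> u" using A1_B by (auto simp: B_eq)
  then have "fst (last A1) \<noteq> fst u" using eq_fst \<open>last A1 \<in> _\<close> \<open>u \<in> _\<close> in_p by blast
  ultimately show "fst (last A1) < fst u" by simp
  show "snd (hd C) < snd (last A1)" using A_props(3) ne C_ne by (simp add: A_eq chain_append)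
qed

text \<open>This excludes that a competitor of \<open>A\<close> continues from \<open>C\<close>
  along \<open>B2\<close>.\<close>

lemma hd_B2: "B2 \<noteq> [] \<Longrightarrow> snd (hd B2) < snd w"
proof -
  assume ne: "B2 \<noteq> []"
  have "A = (A1 @ butlast C) @ last C # w # tl A2" "B = (B1 @ butlast C) @ last C # hd B2 # tl B2"
    using ne A2_ne C_ne by (simp_all add: A_eq B_eq)
  then have "snd (hd B2) \<le> snd w" by (rule exit_order)
  moreover have "hd B2 \<in> set B2" "w \<in> set A2" using ne A2_ne by simp_all
  then have "w \<noteq> hd B2" using A2_B by (auto simp: B_eq)
  then have "snd w \<noteq> snd (hd B2)" using eq_snd \<open>hd B2 \<in> _\<close> \<open>w \<in> _\<close> in_p by blast
  ultimately show "snd (hd B2) < snd w" by simp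
qed

lemma links_B: "links B = links B1 @ u' # links (C @ B2)"
  using links_append[of B1 "C @ B2"] B1_ne C_ne by (simp add: B_eq)

lemma links_C_sub: "set (links C) \<subseteq> set (links B)"
  using links_append[of C B2] C_ne by (cases "B2 = []") (auto simp: links_B)

lemma u'_shift_core: "u' \<in> shift_core"
  by (simp add: shift_core_def links_B)

lemma links_C_inner:
  assumes "z \<in> set (links C)"
  shows "fst u < fst z" "fst z < fst (last C)" "snd w < snd z" "snd z < snd (hd C)"
proof -
  obtain xs c d ys where C: "C = xs @ c # d # ys" "z = (fst c, snd d)" using assms by (rule in_linksE)
  have cd: "fst c < fst d" "snd d < snd c"
    using chains(5) C(1) by (auto simp: chain_append chain_Cons)
  have in_C: "c \<in> set C" "d \<in> set C" using C(1) by auto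
  note c = chain_bounds[OF chains(5) in_C(1)] and d = chain_bounds[OF chains(5) in_C(2)]
  show "fst u < fst z" "fst z < fst (last C)" "snd w < snd z" "snd z < snd (hd C)"
    using c d cd around_C C(2) by auto
qed

lemma inner_bounds:
  assumes "z \<in> Q"
  shows "fst u < fst z" "fst z < fst (last C)" "snd w < snd z" "snd z < snd (hd C)"
  using assms links_C_inner unfolding inner_def by blast+

lemma inner_shift_core: "Q \<subseteq> shift_core"
proof
  fix z assume z: "z \<in> Q"
  have "z \<notin> set B1" using chain_bounds(2)[OF chains(3)] inner_bounds(1)[OF z] by fastforce
  moreover have "z \<notin> set B2"
  proof
    assume z2: "z \<in> set B2"
    then have "fst (last C) < fst (hd B2)"
      using B_props(3) C_ne by (cases B2) (auto simp: B_eq chain_append)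
    then show False using chain_bounds(1)[OF chains(4) z2] inner_bounds(2)[OF z] by simp
  qed
  moreover have "set B = set B1 \<union> set C \<union> set B2" by (simp add: B_eq Un_assoc)
  ultimately show "z \<in> shift_core" using z links_C_sub unfolding inner_def shift_core_def by blast
qed

lemma shift_core_sub: "shift_core \<subseteq> cyclic_shift p B"
  using B_shift_cases by blast

lemma chain_A':
  assumes "chain ys" "set ys \<subseteq> Q"
  shows "chain (u' # ys @ A2)"
proof (cases "ys = []")
  case True
  then show ?thesis using chains A2_ne around_C chain_bounds[OF chains(5), of "last C"] C_ne
     by (auto simp: chain_Cons)
next
  case False
  then have "hd ys \<in> Q" "last ys \<in> Q" using assms(2) by auto
  then show ?thesis
    using False assms(1) chains(2) inner_bounds[of "hd ys"] inner_bounds[of "last ys"] around_C(3)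
    by (auto simp: chain_Cons chain_append)
qed

text \<open>Such a chain, put between \<open>u'\<close> and \<open>A2\<close> and carried back into
  \<open>p\<close>, would start in the row of \<open>hd C\<close>, hence at \<open>hd C\<close>;
  behind \<open>A1\<close> it would give \<open>k + 1\<close> dots under the corner of
  \<open>A\<close>.\<close>

lemma no_longer_chain:
  assumes "chain ys" "set ys \<subseteq> Q"
  shows "length ys \<noteq> length C"
proof
  assume len: "length ys = length C"
  have "set (u' # ys @ A2) \<subseteq> shift_core"
    using u'_shift_core assms(2) inner_shift_core in_p(2) A2_B by (auto simp: shift_core_def)
  then obtain F where F: "chain F" "set F \<subseteq> p" "length F = length (u' # ys @ A2)"
    "snd (hd F) = snd (hd C)" "fst (last F) \<le> max (fst (last A2)) (fst (last B))"
    using transport[OF chain_A'[OF assms]] A2_ne by auto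
  have ne: "F \<noteq> []" using F(3) by auto
  have "hd F \<in> p" "hd C \<in> p" using ne F(2) C_ne in_p(5) by auto
  then have hd: "hd F = hd C" using F(4) eq_snd by blast
  have last: "last A = last A2" using A2_ne by (simp add: A_eq)
  have "length (A1 @ F) \<le> k"
  proof (rule length_le_A)
    show "chain (A1 @ F)"
      using A_props(3) F(1) hd ne C_ne by (auto simp: A_eq chain_append)
    show "set (A1 @ F) \<subseteq> p" using F(2) in_p(1) by simp
    show "snd (hd (A1 @ F)) \<le> snd (hd A)" using hd ne C_ne by (simp add: A_eq hd_append)
    show "fst (last (A1 @ F)) \<le> fst (last A)" using F(5) ne last cross(2) by auto
  qed
  then show False using F(3) len A_props(1) by (simp add: A_eq)
qed

lemma least_exists: "\<exists>ys. least_chain Q (length C - 1) ys"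
proof (rule least_chain_exists)
  \<comment> \<open>\<open>Q\<close> mixes old dots and links, so distinct rows and columns are
    inherited from the B-shift and not from \<open>p\<close>.\<close>
  have "Q \<subseteq> cyclic_shift p B" using inner_shift_core shift_core_sub by blast
  then show "inj_on fst Q" "inj_on snd Q"
    using inj_on_cyclic_shift[OF inj_fst inj_snd B_props(2,3)] by (auto intro: inj_on_subset)
  show "chain (links C)" using chains(5) by (rule chain_links)
  show "set (links C) \<subseteq> Q" by (simp add: inner_def)
  fix gs assume "chain gs" "set gs \<subseteq> Q"
  then show "length gs \<noteq> Suc (length C - 1)" using no_longer_chain C_ne by simp
qed simp

lemma least_le_links:
  assumes "least_chain Q (length C - 1) ys" "r < length C - 1"
  shows "fst (ys ! r) \<le> fst (C ! r)" "snd (ys ! r) \<le> snd (C ! Suc r)"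
proof -
  have "chain (links C)" "set (links C) \<subseteq> Q" "length (links C) = length C - 1"
    using chain_links[OF chains(5)] by (auto simp: inner_def)
  then have "fst (ys ! r) \<le> fst (links C ! r) \<and> snd (ys ! r) \<le> snd (links C ! r)"
    using assms unfolding least_chain_def by blast
  moreover have "links C ! r = (fst (C ! r), snd (C ! Suc r))" using assms(2) by (intro nth_links) simp
  ultimately show "fst (ys ! r) \<le> fst (C ! r)" "snd (ys ! r) \<le> snd (C ! Suc r)" by simp_all
qed

text \<open>Links of \<open>C\<close> occur in the least chain only at their own index, so that an initial piece ending
  in such a link can be exchanged for an initial piece of \<open>B\<close>.\<close>

lemma prefix_chain:
  assumes "least_chain Q (length C - 1) ys" "r \<le> length C - 1"
  shows "\<exists>P. chain P \<and> set P \<subseteq> p \<and> P \<noteq> [] \<and> length P = length B1 + r \<and> hd P = hd B \<and>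
    fst (last P) = fst (last (u' # take r ys)) \<and> snd (last (u' # take r ys)) \<le> snd (last P)"
  using assms(2)
proof (induction r)
  case 0
  then show ?case
    using chains(3) in_p(3) B1_ne around_C(2) by (intro exI[of _ B1]) (simp add: B_eq)
next
  case (Suc r)
  let ?y = "ys ! r"
  have ys: "chain ys" "set ys \<subseteq> Q" "length ys = length C - 1" using assms(1) by (auto simp: least_chain_def)
  have take: "take (Suc r) ys = take r ys @ [?y]" using Suc.prems ys(3) by (simp add: take_Suc_conv_app_nth)
  have y: "?y \<in> Q" using Suc.prems ys by auto
  obtain P where P: "chain P" "set P \<subseteq> p" "P \<noteq> []" "length P = length B1 + r" "hd P = hd B"
    "fst (last P) = fst (last (u' # take r ys))" "snd (last (u' # take r ys)) \<le> snd (last P)"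
    using Suc by auto
  show ?case
  proof (cases "?y \<in> set (links C)")
    case True
    then obtain i where i: "?y = links C ! i" "Suc i < length C"
      by (metis in_set_conv_nth length_links less_diff_conv Suc_eq_plus1)
    then have y_eq: "?y = (fst (C ! i), snd (C ! Suc i))" by (simp add: nth_links)
    \<comment> \<open>Comparing \<open>ys\<close> with the link of index \<open>r\<close>, the
      column gives \<open>i \<le> r\<close> and the row gives \<open>r \<le> i\<close>.\<close>
    have "fst (C ! i) \<le> fst (C ! r)" "snd (C ! Suc i) \<le> snd (C ! Suc r)"
      using least_le_links[OF assms(1), of r] Suc.prems y_eq by simp_all
    moreover have r: "Suc r < length C" using Suc.prems C_ne by (cases C) auto
    ultimately have "i \<le> r" "r \<le> i"
      using chain_nth_fst[OF chains(5), of r i] chain_nth_snd[OF chains(5), of "Suc r" "Suc i"] i(2)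
      by simp_all
    then have y_eq: "?y = (fst (C ! r), snd (C ! Suc r))" using y_eq by simp
    \<comment> \<open>The last dot \<open>C ! r\<close> has the column of the link and lies above
      it.\<close>
    let ?P = "B1 @ take (Suc r) C"
    have "chain ?P" using chains(3) chain_take[OF chains(5)] around_C by (simp add: chain_append)
    moreover have "set ?P \<subseteq> p" using in_p by (auto dest: in_set_takeD)
    moreover have "hd ?P = hd B" using B1_ne by (simp add: B_eq)
    moreover have "last ?P = C ! r" using r by (simp add: take_Suc_conv_app_nth)
    moreover have "snd (C ! Suc r) \<le> snd (C ! r)" using chain_nth[OF chains(5), of r "Suc r"] r by simp
    moreover have "last (u' # take (Suc r) ys) = ?y" by (simp add: take)
    ultimately show ?thesis using B1_ne r y_eq by (intro exI[of _ ?P]) simp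
  next
    case False
    then have yp: "?y \<in> p" using y by (auto simp: inner_def)
    have "chain (u' # ys)"
      using chain_A'[OF ys(1,2)] chain_append[of "u' # ys" A2] by simp
    moreover have "u' # ys = (u' # take r ys) @ ?y # drop (Suc r) ys"
      using Suc.prems ys(3) by (simp add: id_take_nth_drop[symmetric])
    ultimately have "chain ((u' # take r ys) @ ?y # drop (Suc r) ys)" by metis
    then have "fst (last (u' # take r ys)) < fst ?y" "snd ?y < snd (last (u' # take r ys))"
      unfolding chain_append by simp_all
    then have "chain (P @ [?y])" using P by (simp add: chain_append chain_Cons)
    moreover have "last (u' # take (Suc r) ys) = ?y" by (simp add: take)
    ultimately show ?thesis using P yp by (intro exI[of _ "P @ [?y]"]) simp
  qed
qed

text \<open>Greediness at a cut inside \<open>u' # ys\<close>, where \<open>q\<close> counts the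
  dots from \<open>u'\<close> on that are already placed. The carried competitor \<open>F\<close>
  starts left of the \<open>q\<close>-th dot of \<open>C\<close>, since it would otherwise undercut
  \<open>A\<close>, so \<open>repair\<close> pushes it onto \<open>B\<close>. If the result runs on
  into \<open>B2\<close>, it contradicts \<open>A\<close> at \<open>w\<close>. Otherwise the
  replaced dots of \<open>F\<close> lie in the rectangle and complete a chain there that contradicts
  leastness of \<open>ys\<close>.\<close>

lemma inside_bound:
  assumes least: "least_chain Q (length C - 1) ys" and q: "1 \<le> q" "q \<le> length C"
    and E: "chain E" "set E \<subseteq> shift_core" "length A1 + q + length E = k"
    and pre: "fst (last (u' # take (q - 1) ys)) < fst (hd E)" "snd (hd E) < snd (last (u' # take (q - 1) ys))"
    and corner: "(fst (last E), snd (hd A)) \<in> L"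
  shows "snd (hd (drop (q - 1) ys @ A2)) \<le> snd (hd E)"
proof (rule ccontr)
  let ?V = "drop (q - 1) ys @ A2" and ?c = "C ! (q - 1)" and ?R = "drop q C @ A2"
  assume "\<not> snd (hd ?V) \<le> snd (hd E)"
  then have lt: "snd (hd E) < snd (hd ?V)" by simp
  have ys: "chain ys" "set ys \<subseteq> Q" "length ys = length C - 1" using least by (auto simp: least_chain_def)
  have lenA: "length A1 + length C + length A2 = k" using A_props(1) by (simp add: A_eq)
  have lenR: "length E = length ?R" using lenA E(3) q by simp
  then have E_ne: "E \<noteq> []" using A2_ne by auto
  \<comment> \<open>\<open>ys\<close> lies weakly below the links of \<open>C\<close>, so a start
    lower than the new sequence is also lower than \<open>A\<close> after \<open>q\<close> dots of
    \<open>C\<close>.\<close>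
  have VR: "snd (hd ?V) \<le> snd (hd ?R)"
  proof (cases "q = length C")
    case False
    then have "q - 1 < length ys" "q < length C" using q ys(3) by linarith+
    then have "hd ?V = ys ! (q - 1)" "hd ?R = C ! q" by (simp_all add: hd_append hd_drop_conv_nth)
    then show ?thesis using least_le_links(2)[OF least, of "q - 1"] q False by simp
  qed (use ys(3) in simp)
  have take_q: "take q C = take (q - 1) C @ [?c]"
    using q take_Suc_conv_app_nth[of "q - 1" C] by simp
  have drop_q: "drop (q - 1) C = ?c # drop q C"
    using q Cons_nth_drop_Suc[of "q - 1" C] by simp
  have A_split: "A = (A1 @ take q C) @ ?R" by (simp add: A_eq)
  have B_split: "B = (B1 @ take (q - 1) C) @ ?c # drop q C @ B2"
    using drop_q append_take_drop_id[of "q - 1" C] by (simp add: B_eq)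
  have c: "?c \<in> p" "?c \<in> set C" using q in_p(5) by auto
  have "A = (A1 @ take (q - 1) C) @ ?c # ?R" unfolding A_split take_q by simp
  then have chain_AC: "chain ((A1 @ take (q - 1) C) @ [?c])" and "chain (?c # ?R)"
    using A_props(3) chain_glue by metis+
  then have cR: "snd (hd ?R) < snd ?c" using A2_ne by (simp add: chain_Cons)
  obtain F where F: "chain F" "set F \<subseteq> p" "length F = length E" "snd (hd F) = snd (hd E)"
    "fst (hd E) \<le> fst (hd F)" "fst (last F) \<le> max (fst (last E)) (fst (last B))"
    using transport E E_ne by blast
  have F_ne: "F \<noteq> []" using F(3) E_ne by auto
  have F_lt: "snd (hd F) < snd (hd ?R)" "snd (hd F) < snd ?c" using lt VR cR F(4) by simp_all
  have hdF: "hd F \<in> p" "last F \<in> p" using F_ne F(2) by auto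
  have posA: "1 \<le> snd (hd A)" using p_pos(2)[of "hd A"] hd_in_set[OF A_props(4)] A_props(2) by blast
  \<comment> \<open>\<open>E\<close> may end to the right of \<open>A\<close>; in those columns the
    board is known only from the corner assumption on \<open>E\<close>.\<close>
  have board: "(i, snd (hd A)) \<in> L" if "1 \<le> i" "i \<le> max (fst (last F)) (fst (last B))" for i
  proof (cases "i \<le> fst (last E)")
    case True then show ?thesis using L_down[OF corner that(1)] posA by simp
  next
    case False
    then have "i \<le> fst (last A)" using that(2) F(6) cross(2) by auto
    then show ?thesis using cornerA that(1) posA by simp
  qed
  have hd_take: "hd (A1 @ take i C @ T) = hd A" if "i \<ge> 1" for i T
    using C_ne that by (cases A1) (simp_all add: A_eq hd_append)
  have left: "fst (hd F) < fst ?c"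
  proof (rule ccontr)
    assume "\<not> fst (hd F) < fst ?c"
    moreover have "fst (hd F) \<noteq> fst ?c" using eq_fst[OF hdF(1) c(1)] F_lt by auto
    ultimately have "fst ?c < fst (hd F)" by simp
    then have "chain (?c # F)" using F(1) F_lt(2) by (simp add: chain_Cons)
    then have "chain ((A1 @ take (q - 1) C) @ ?c # F)" using chain_AC chain_glue by blast
    then have "chain ((A1 @ take q C) @ F)" unfolding take_q by simp
    moreover have "(fst (last ((A1 @ take q C) @ F)), snd (hd ((A1 @ take q C) @ F))) \<in> L"
      using board[of "fst (last F)"] p_pos(1)[OF hdF(2)] hd_take[OF q(1)] F_ne by simp
    ultimately have "snd (hd ?R) \<le> snd (hd F)"
      using minA[OF A_split _ F(2)] lenR F(3) A2_ne by auto
    then show False using F_lt(1) by simp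
  qed
  \<comment> \<open>\<open>repair\<close> needs a prefix inside \<open>p\<close>. This one replaces
    the new dots, ends in the same column, and is as long as the part of \<open>B\<close> before
    \<open>?c\<close>.\<close>
  obtain P where P: "chain P" "set P \<subseteq> p" "P \<noteq> []" "length P = length B1 + (q - 1)" "hd P = hd B"
    "fst (last P) = fst (last (u' # take (q - 1) ys))" "snd (last (u' # take (q - 1) ys)) \<le> snd (last P)"
    using prefix_chain[OF least diff_le_mono[OF q(2)]] by blast
  have "chain (P @ F)" using P F pre F_ne by (auto simp: chain_append)
  then obtain l where l: "1 \<le> l" "l \<le> length F" "l \<le> length (drop q C @ B2)"
    "chain (?c # take l (drop q C @ B2) @ drop l F)"
    "\<forall>i<l. fst (F ! i) < fst ((?c # drop q C @ B2) ! i) \<and> snd (F ! i) < snd ((drop q C @ B2) ! i)"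
    using repair[OF B_split, of P F] P F F_ne left q by auto
  let ?G = "take l (drop q C @ B2) @ drop l F"
  have "chain ((A1 @ take (q - 1) C) @ ?c # ?G)" using chain_AC l(4) chain_glue by blast
  then have chain_G: "chain (A1 @ take q C @ ?G)" unfolding take_q by simp
  have G_p: "set ?G \<subseteq> p" using F(2) in_p by (auto dest!: in_set_takeD in_set_dropD)
  show False
  proof (cases "q + l \<le> length C")
    case False
    let ?n = "q + l - length C"
    have G: "take q C @ ?G = C @ take ?n B2 @ drop l F"
      using False q by (simp add: add.commute)
    have B2: "B2 \<noteq> []" "1 \<le> ?n" using False l(3) q by auto
    have hdB2: "hd (take ?n B2 @ drop l F) = hd B2" using B2 False by simp
    let ?T = "take ?n B2 @ drop l F"
    have T_ne: "?T \<noteq> []" using B2 False by simp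
    have last_T: "last ?T = last (?c # ?G)"
    proof -
      have "last (take q C @ ?G) = last ?T"
        unfolding G by (rule last_appendR) (rule T_ne)
      moreover have "?G \<noteq> []" using l B2 by auto
      ultimately show ?thesis by (metis last_appendR last_ConsR)
    qed
    have "fst (last ?T) \<le> max (fst (last F)) (fst (last B))"
      using last_repaired[OF B_split l(2) F_ne] last_T by simp
    moreover have T_p: "set ?T \<subseteq> p" using in_p(4) F(2) by (auto dest!: in_set_takeD in_set_dropD)
    then have "last ?T \<in> p" using last_in_set[OF T_ne] by blast
    moreover have "hd (A1 @ C @ ?T) = hd A" using hd_take[of "length C" ?T] C_ne by (cases C) auto
    ultimately have "(fst (last ((A1 @ C) @ ?T)), snd (hd ((A1 @ C) @ ?T))) \<in> L"
      using board p_pos(1) T_ne by simp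
    moreover have "chain ((A1 @ C) @ ?T)" using chain_G unfolding G by simp
    moreover have "length ?T = length A2" using lenR F(3) q False l(2,3) by simp
    ultimately have "snd w \<le> snd (hd ?T)" using T_p A2_ne by (intro minA[of "A1 @ C"]) (auto simp: A_eq)
    then show False using hd_B2 B2(1) hdB2 by simp
  next
    case True
    let ?X = "A1 @ take (q + l) C" and ?Y = "drop (q + l) C @ A2" and ?T = "drop l F"
    have len_T: "length ?T = length ?Y" using lenR F(3) True l(2) by simp
    then have T_ne: "?T \<noteq> []" using A2_ne by auto
    then have lF: "l < length F" by simp
    have "?X @ ?T = A1 @ take q C @ ?G" using True by (simp add: take_add)
    then have "chain (?X @ ?T)" using chain_G by simp
    moreover have "last ?T = last F" using lF by (simp add: last_drop)
    then have "(fst (last (?X @ ?T)), snd (hd (?X @ ?T))) \<in> L"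
      using board[of "fst (last F)"] p_pos(1)[OF hdF(2)] hd_take[of "q + l"] q(1) T_ne by simp
    moreover have "A = ?X @ ?Y" by (simp add: A_eq)
    moreover have "set ?T \<subseteq> p" using F(2) by (auto dest!: in_set_dropD)
    ultimately have "snd (hd ?Y) \<le> snd (hd ?T)" using len_T A2_ne by (intro minA[of ?X]) auto
    \<comment> \<open>The dots of \<open>F\<close> before index \<open>l\<close> are higher still,
      which puts them above \<open>w\<close>.\<close>
    then have above: "snd (hd ?Y) \<le> snd (F ! l)" using lF by (simp add: hd_drop_conv_nth)
    have w_le: "snd w \<le> snd (hd ?Y)"
    proof (cases "drop (q + l) C = []")
      case False
      then have "hd ?Y \<in> set C" by (metis hd_append2 hd_in_set in_set_dropD)
      then show ?thesis using chain_bounds(3)[OF chains(5)] around_C(4) by fastforce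
    qed simp
    let ?N = "drop (q + l - 1) (links C)"
    \<comment> \<open>The length is
      \<open>(q - 1) + l + (length C - 1 - (q + l - 1)) = length C - 1\<close>, with the links of
      \<open>C\<close> filling the remaining indices.\<close>
    let ?H = "take (q - 1) ys @ take l F @ ?N"
    have F_nth: "fst (F ! i) < fst (C ! (q + i - 1))" "snd (F ! i) < snd (C ! (q + i))"
      "F ! i \<in> Q" if "i < l" for i
    proof -
      have "?c # drop q C @ B2 = drop (q - 1) C @ B2" using drop_q by simp
      moreover have "i < length (drop (q - 1) C)" "i < length (drop q C)" "q - 1 + i = q + i - 1"
        using that True q by simp_all
      ultimately have cC: "(?c # drop q C @ B2) ! i = C ! (q + i - 1)" "(drop q C @ B2) ! i = C ! (q + i)"
        using q by (simp_all only: nth_append if_True nth_drop diff_le_self order_trans)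
      then show lt1: "fst (F ! i) < fst (C ! (q + i - 1))" "snd (F ! i) < snd (C ! (q + i))"
        using l(5) that by metis+
      have iF: "i < length F" using that l(2) by simp
      then have Fi: "F ! i \<in> set F" by simp
      \<comment> \<open>Being left of \<open>C ! (q + i - 1)\<close> forces a smaller index than
        that, being lower than \<open>C ! (q + i)\<close> a larger one than
        \<open>q + i\<close>.\<close>
      have "F ! i \<notin> set C"
      proof
        assume "F ! i \<in> set C"
        then obtain j where j: "F ! i = C ! j" "j < length C" by (metis in_set_conv_nth)
        then have "j < q + i - 1" "q + i < j"
          using lt1 chain_nth_fst[OF chains(5), of j "q + i - 1"] chain_nth_snd[OF chains(5), of j "q + i"]
            that True by simp_all
        then show False by simp
      qed
      moreover have "fst u < fst (F ! i)"
      proof -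
        have "fst u \<le> fst (last (u' # take (q - 1) ys))"
        proof (cases "take (q - 1) ys = []")
          case False
          then have "last (take (q - 1) ys) \<in> Q" using ys(2) by (metis in_set_takeD last_in_set subsetD)
          then show ?thesis using inner_bounds(1) False by (simp add: less_imp_le)
        qed simp
        then show ?thesis using pre(1) F(5) chain_bounds(1)[OF F(1) Fi] by simp
      qed
      moreover have "fst (F ! i) < fst (last C)"
        using lt1(1) chain_bounds(2)[OF chains(5), of "C ! (q + i - 1)"] that True by simp
      moreover have "snd w < snd (F ! i)"
        using chain_nth[OF F(1) that lF] above w_le by simp
      moreover have "snd (F ! i) < snd (hd C)"
        using chain_bounds(4)[OF F(1) Fi] F_lt(2) chain_bounds(4)[OF chains(5) c(2)] by simp
      ultimately show "F ! i \<in> Q" using Fi F(2) by (auto simp: inner_def)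
    qed
    have "chain ?N" using chain_links[OF chains(5)] by (rule chain_drop)
    moreover have "fst (F ! (l - 1)) < fst (hd ?N)" "snd (hd ?N) < snd (F ! (l - 1))" if N: "?N \<noteq> []"
    proof -
      have ql: "q + l < length C" using N by simp
      then have "hd ?N = (fst (C ! (q + l - 1)), snd (C ! (q + l)))"
        using l(1) by (simp add: hd_drop_conv_nth nth_links)
      moreover have "fst (F ! (l - 1)) < fst (C ! (q + l - 2))" using F_nth(1)[of "l - 1"] l(1) by (simp add: numeral_2_eq_2)
      moreover have "fst (C ! (q + l - 2)) < fst (C ! (q + l - 1))"
        using chain_nth[OF chains(5), of "q + l - 2" "q + l - 1"] ql l(1) q(1) by simp
      moreover have "hd ?Y = C ! (q + l)" using ql by (simp add: hd_append hd_drop_conv_nth)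
      moreover have "snd (F ! l) < snd (F ! (l - 1))" using chain_nth[OF F(1), of "l - 1" l] lF l(1) by simp
      ultimately show "fst (F ! (l - 1)) < fst (hd ?N)" "snd (hd ?N) < snd (F ! (l - 1))"
        using above by simp_all
    qed
    moreover have last_F: "last (take l F) = F ! (l - 1)" "hd (take l F) = hd F" "take l F \<noteq> []"
      using l(1) lF F_ne by (simp_all add: last_conv_nth min_def)
    ultimately have "chain (take l F @ ?N)" using chain_take[OF F(1)] by (auto simp: chain_append)
    moreover have "fst (last (take (q - 1) ys)) < fst (hd F) \<and> snd (hd F) < snd (last (take (q - 1) ys))"
      if "take (q - 1) ys \<noteq> []"
      using pre F(4,5) that by simp
    ultimately have "chain ?H" using chain_take[OF ys(1)] last_F by (auto simp: chain_append)
    moreover have "set ?H \<subseteq> Q"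
    proof -
      have "set (take l F) \<subseteq> Q"
      proof
        fix z assume "z \<in> set (take l F)"
        then obtain i where "z = F ! i" "i < l" by (auto simp: in_set_conv_nth)
        then show "z \<in> Q" using F_nth(3) by simp
      qed
      moreover have "set ?N \<subseteq> Q" by (auto simp: inner_def dest: in_set_dropD)
      moreover have "set (take (q - 1) ys) \<subseteq> Q" using ys(2) by (auto dest: in_set_takeD)
      ultimately show ?thesis by simp
    qed
    moreover have "length ?H = length C - 1" using True ys(3) lF l(1) q(1) by simp
    moreover have q_lt: "q < length C" using True l(1) by simp
    ultimately have "snd (ys ! (q - 1)) \<le> snd (?H ! (q - 1))"
      using least q(1) unfolding least_chain_def by (metis diff_less_mono)
    moreover have q_ys: "q - 1 < length ys" using q_lt q(1) ys(3) by linarith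
    then have "?H ! (q - 1) = hd F" using last_F l(1) by (simp add: nth_append hd_conv_nth F_ne)
    moreover have "hd ?V = ys ! (q - 1)" using q_ys by (simp add: hd_append hd_drop_conv_nth)
    ultimately show False using lt F(4) by simp
  qed
qed

text \<open>\<open>u' # ys\<close> has the length of \<open>C\<close>, and \<open>u'\<close> the row
  of \<open>hd C\<close>. Cuts up to \<open>u'\<close> or inside \<open>A2\<close> therefore reduce
  to cuts of \<open>A\<close>; the others are the subject of \<open>inside_bound\<close>.\<close>

theorem greedyA_B_shift:
  assumes least: "least_chain Q (length C - 1) ys"
  shows "greedyA k L (cyclic_shift p B) (A1 @ u' # ys @ A2)"
  unfolding greedyA_def
proof (intro conjI allI impI; (elim conjE)?)
  let ?A = "A1 @ u' # ys @ A2"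
  have ys: "chain ys" "set ys \<subseteq> Q" "length ys = length C - 1" using least by (auto simp: least_chain_def)
  have lenC: "length C = Suc (length ys)" using ys(3) C_ne by (cases C) auto
  have cA': "chain ?A"
    using chain_A'[OF ys(1,2)] chains(1) last_A1 by (auto simp: chain_append)
  have hd_A': "snd (hd ?A) = snd (hd A)" using C_ne by (cases A1) (simp_all add: A_eq)
  have last_A': "last ?A = last A" using A2_ne by (simp add: A_eq)
  have "set A1 \<subseteq> shift_core" "set A2 \<subseteq> shift_core" using in_p A1_B A2_B by (auto simp: shift_core_def)
  then have "set ?A \<subseteq> cyclic_shift p B" using ys(2) inner_shift_core u'_shift_core shift_core_sub by auto
  then show "occurrence k L (cyclic_shift p B) ?A"
    using cA' hd_A' last_A' A_props(1,5) lenC by (simp add: occurrence_iff A_eq)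
  fix X V E assume a: "?A = X @ V" "V \<noteq> []" "occurrence k L (cyclic_shift p B) (X @ E)"
  have len: "length X + length E = k" using a(3) by (auto simp: occurrence_iff)
  have lenA: "length A1 + length C + length A2 = k" using A_props(1) by (simp add: A_eq)
  have "length ?A = length X + length V" unfolding a(1) by simp
  then have lenV: "length E = length V" "length X + length V = k" using lenA lenC len by auto
  have ne: "E \<noteq> []" using lenV a(2) by auto
  have cE: "chain E" "set E \<subseteq> cyclic_shift p B"
    and XE: "X \<noteq> [] \<Longrightarrow> fst (last X) < fst (hd E) \<and> snd (hd E) < snd (last X)"
    and corner: "(fst (last E), snd (hd (X @ E))) \<in> L"
    using a(3) ne by (auto simp: occurrence_iff chain_append)
  show "snd (hd V) \<le> snd (hd E)"
  proof (rule ccontr)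
    assume "\<not> snd (hd V) \<le> snd (hd E)"
    then have lt: "snd (hd E) < snd (hd V)" by simp
    have "hd V \<in> set ?A" using a(1,2) by simp
    then have "snd (hd V) \<le> snd (hd B)" using chain_bounds(4)[OF cA'] hd_A' cross(1) by fastforce
    then have E_old: "set E \<subseteq> shift_core" using below_B_in_shift_core[OF cE] lt by simp
    have top: "snd (hd (X @ E)) \<le> snd (hd A)"
      using lt a(1) hd_A' by (cases X) auto
    \<comment> \<open>A cut right after \<open>ys\<close> counts as \<open>inside\<close>, with
      \<open>q = length C\<close>, since the prefix then does not yet end in a dot of
      \<open>A\<close>.\<close>
    consider (before) "length X \<le> length A1" | (after) "length A1 + length C < length X"
      | (inside) q where "1 \<le> q" "q \<le> length C" "length X = length A1 + q"
    proof -
      have "1 \<le> length X - length A1 \<and> length X - length A1 \<le> length C \<and>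
          length X = length A1 + (length X - length A1)"
        if "\<not> length X \<le> length A1" "\<not> length A1 + length C < length X"
        using that by linarith
      then show ?thesis using that by blast
    qed
    then show False
    proof cases
      case before
      have T: "A1 = X @ drop (length X) A1" "V = drop (length X) A1 @ u' # ys @ A2"
        using arg_cong[OF a(1), of "take (length X)"] arg_cong[OF a(1), of "drop (length X)"] before
          append_take_drop_id[of "length X" A1] by simp_all
      let ?T = "drop (length X) A1"
      have "A = X @ ?T @ C @ A2" using T(1) A_eq by (metis append.assoc)
      moreover have "length E = length (?T @ C @ A2)" using lenV(1) T(2) lenC by simp
      ultimately have "snd (hd (?T @ C @ A2)) \<le> snd (hd E)"
        using E_old cE(1) XE corner C_ne by (intro minA_transport[of X]) auto
      moreover have "snd (hd (?T @ C @ A2)) = snd (hd V)" using T(2) C_ne by (cases ?T) auto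
      ultimately show False using lt by simp
    next
      case after
      let ?n = "length X - (length A1 + length C)"
      let ?T = "take ?n A2"
      have T: "X = A1 @ u' # ys @ ?T" "V = drop ?n A2"
        using arg_cong[OF a(1), of "take (length X)"] arg_cong[OF a(1), of "drop (length X)"] after lenC
        by (simp_all add: take_Cons' drop_Cons')
      \<comment> \<open>Replacing \<open>u' # ys\<close> by \<open>C\<close> leaves the last dot of
        the prefix unchanged only if the prefix reaches into \<open>A2\<close>.\<close>
      have T_ne: "?T \<noteq> []" using after A2_ne by simp
      have "A = (A1 @ C @ ?T) @ V" using T(2) A_eq by simp
      moreover have "snd (hd ((A1 @ C @ ?T) @ E)) = snd (hd (X @ E))"
        using C_ne by (subst T(1)) (cases A1; simp add: hd_append)
      moreover have "last X = last (A1 @ C @ ?T)" using T_ne by (subst T(1)) simp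
      moreover have "X \<noteq> []" using after by auto
      ultimately have "snd (hd V) \<le> snd (hd E)"
        using E_old cE(1) XE corner a(2) lenV(1) by (intro minA_transport[of "A1 @ C @ ?T"]) simp_all
      then show False using lt by simp
    next
      case (inside q)
      have T: "X = A1 @ u' # take (q - 1) ys" "V = drop (q - 1) ys @ A2"
        using arg_cong[OF a(1), of "take (length X)"] arg_cong[OF a(1), of "drop (length X)"] inside lenC
        by (simp_all add: take_Cons' drop_Cons')
      have "snd (hd X) = snd (hd A)" using T(1) C_ne by (cases A1) (simp_all add: A_eq)
      then have "(fst (last E), snd (hd A)) \<in> L" using corner T(1) by (metis Nil_is_append_conv hd_append2 list.distinct(1))
      moreover have "last X = last (u' # take (q - 1) ys)" "X \<noteq> []" using T(1) by simp_all
      ultimately have "snd (hd (drop (q - 1) ys @ A2)) \<le> snd (hd E)"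
        using XE cE E_old len inside by (intro inside_bound[OF least]) auto
      then show False using lt T(2) by simp
    qed
  qed
qed

end

section \<open>Commutation\<close>

lemma links_glue: "links (xs @ c # ys) = links (xs @ [c]) @ links (c # ys)"
proof (cases "xs = []")
  case False
  then show ?thesis using links_append[of xs "[c]"] links_append[of xs "c # ys"] by simp
qed simp

lemma links_reflect: "links (reflect ds) = reflect (links ds)"
proof (induction ds)
  case (Cons x ds)
  show ?case
  proof (cases ds)
    case (Cons y zs)
    then have "links (reflect ds @ [prod.swap x]) = links (reflect ds) @ [(snd y, fst x)]"
      using links_append[of "reflect ds" "[prod.swap x]"] by (simp add: reflect_last)
    then show ?thesis using Cons Cons.IH by simp
  qed simp
qed simp

lemma cyclic_shift_reflect:
  assumes "ds \<noteq> []"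
  shows "cyclic_shift (prod.swap ` p) (reflect ds) = prod.swap ` cyclic_shift p ds"
proof -
  have "prod.swap ` (p - set ds) = prod.swap ` p - prod.swap ` set ds"
    by (rule image_set_diff) (rule inj_swap)
  then show ?thesis
    using assms by (simp add: cyclic_shift_eq links_reflect image_Un reflect_last reflect_hd)
qed

lemma inner_reflect:
  assumes "C \<noteq> []"
  shows "inner (prod.swap w) (prod.swap u) (reflect C) (prod.swap ` p) = prod.swap ` inner u w C p"
  using assms by (auto simp: inner_def links_reflect reflect_last reflect_hd swap_image_iff image_Un)

lemma least_chain_reflect:
  assumes "least_chain Q n ys"
  shows "least_chain (prod.swap ` Q) n (reflect ys)"
  unfolding least_chain_def
proof (intro conjI allI impI; (elim conjE)?)
  show "chain (reflect ys)" "set (reflect ys) \<subseteq> prod.swap ` Q" "length (reflect ys) = n"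
    using assms by (auto simp: least_chain_def)
  fix gs i assume gs: "chain gs" "set gs \<subseteq> prod.swap ` Q" "length gs = n" and i: "i < n"
  have "chain (reflect gs)" "set (reflect gs) \<subseteq> Q" "length (reflect gs) = n"
    using gs by auto
  moreover have "n - Suc i < n" using i by simp
  ultimately have "fst (ys ! (n - Suc i)) \<le> fst (reflect gs ! (n - Suc i)) \<and>
      snd (ys ! (n - Suc i)) \<le> snd (reflect gs ! (n - Suc i))"
    using assms unfolding least_chain_def by blast
  then show "fst (reflect ys ! i) \<le> fst (gs ! i)" "snd (reflect ys ! i) \<le> snd (gs ! i)"
    using assms i gs(3) by (auto simp: reflect_def rev_nth least_chain_def)
qed

section \<open>The dots of the two compositions\<close>

context crossing
begin

text \<open>Each new dot stays in the column of a dot of \<open>B\<close>, and the dots of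
  \<open>p\<close> have distinct columns.\<close>

lemma B_shift_new:
  assumes "z \<in> p - set B" "z' \<in> set (links B) \<union> {(fst (last B), snd (hd B))}"
  shows "z \<noteq> z'"
proof
  assume "z = z'"
  have "\<exists>b \<in> set B. fst z' = fst b"
    using assms(2) B_props(4) by (auto elim!: in_linksE)
  then obtain b where "b \<in> set B" "fst z = fst b" using \<open>z = z'\<close> by blast
  then have "z = b" using eq_fst assms(1) B_props(2) by blast
  then show False using \<open>b \<in> set B\<close> assms(1) by simp
qed

text \<open>The right-hand side is symmetric in \<open>A\<close> and \<open>B\<close>, so the
  mirrored instance gives the same set for the other order.\<close>

lemma shifts_commute_disjoint:
  assumes "set A \<inter> set B = {}"
  shows "cyclic_shift (cyclic_shift p B) A =
    (p - set A - set B) \<union> set (links A) \<union> set (links B) \<union>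
      {(fst (last A), snd (hd A)), (fst (last B), snd (hd B))}"
proof -
  have "set A \<subseteq> p - set B" using A_props(2) assms by blast
  then have "set A \<inter> (set (links B) \<union> {(fst (last B), snd (hd B))}) = {}"
    using B_shift_new by blast
  then show ?thesis unfolding cyclic_shift_eq[OF A_props(4)] cyclic_shift_eq[OF B_props(4)] by blast
qed

end

context crossing_segment
begin

abbreviation "w' \<equiv> (fst (last C), snd (hd A2))"

text \<open>Reflection exchanges \<open>u\<close> and \<open>w\<close> and carries \<open>Q\<close>
  to the rectangle of the mirrored instance, so the same \<open>ys\<close> serves here.\<close>

lemma greedyB_A_shift:
  assumes "least_chain Q (length C - 1) ys"
  shows "greedyB k L (cyclic_shift p A) (B1 @ ys @ w' # B2)"
proof -
  interpret R: crossing_segment k "prod.swap ` L" "prod.swap ` p" "reflect B" "reflect A"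
    "reflect B2" "reflect C" "reflect B1" "reflect A2" "reflect A1" by (rule crossing_segment_reflect)
  have "least_chain R.Q (length (reflect C) - 1) (reflect ys)"
    using least_chain_reflect[OF assms] A2_ne B1_ne C_ne by (simp add: inner_reflect reflect_last reflect_hd)
  from R.greedyA_B_shift[OF this]
  have "greedyA k (prod.swap ` L) (prod.swap ` cyclic_shift p A) (reflect (B1 @ ys @ w' # B2))"
    using A2_ne C_ne A_props(4) by (simp add: cyclic_shift_reflect reflect_last reflect_hd)
  from greedyB_reflect[OF this k_pos] show ?thesis by (simp add: image_image del: reflect_simps(2,3))
qed

text \<open>A form preserved by reflection. The links of \<open>C\<close> outside \<open>ys\<close>
  are made by the first shift and left alone by the second. The middle part can run from
  \<open>u\<close> to \<open>w\<close>, because it takes only the column of \<open>u'\<close> or the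
  row of \<open>w'\<close>.\<close>

definition double_shift where
  "double_shift ys = (p - set A - set B - set ys) \<union> (set (links C) - set ys) \<union>
     set (links (A1 @ [hd C])) \<union> set (links A2) \<union> set (links B1) \<union> set (links (last C # B2)) \<union>
     set (links (u # ys @ [w])) \<union> {(fst (last A), snd (hd A)), (fst (last B), snd (hd B))}"

lemma links_A': "set (links (A1 @ u' # ys @ A2)) =
    set (links (A1 @ [hd C])) \<union> set (links (u # ys @ [w])) \<union> set (links A2)"
proof -
  have "links (A1 @ [u']) = links (A1 @ [hd C])"
    by (cases "A1 = []") (simp_all add: links_append)
  moreover have "links (u' # ys @ A2) = links (u' # ys @ [w]) @ links A2"
    using links_glue[of "u' # ys" w "tl A2"] A2_ne by simp
  moreover have "links (u' # ys @ [w]) = links (u # ys @ [w])" by (cases ys) simp_all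
  ultimately show ?thesis using links_glue[of A1 u' "ys @ A2"] by auto
qed

lemma C_B2: "C @ B2 = butlast C @ last C # B2"
  using append_butlast_last_id[OF C_ne] by (metis append.assoc append_Cons append_Nil)

lemma links_C_B2: "set (links (C @ B2)) = set (links C) \<union> set (links (last C # B2))"
  unfolding C_B2 links_glue[of "butlast C" "last C" B2] using C_ne by simp

lemma shifts_eq_double_shift:
  assumes "chain ys" "set ys \<subseteq> Q"
  shows "cyclic_shift (cyclic_shift p B) (A1 @ u' # ys @ A2) = double_shift ys"
proof -
  let ?A = "A1 @ u' # ys @ A2"
  let ?N = "set (links B1) \<union> set (links (last C # B2)) \<union> {(fst (last B), snd (hd B))}"
  have ends: "snd (hd ?A) = snd (hd A)" "last ?A = last A"
    using C_ne A2_ne by (cases A1; simp add: A_eq)+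
  have new: "set (links B) \<union> {(fst (last B), snd (hd B))} = ?N \<union> {u'} \<union> set (links C)"
    unfolding links_B by (auto simp: links_C_B2)
  \<comment> \<open>Columns keep the new dots apart: \<open>ys\<close> and the links of
    \<open>C\<close> lie strictly between the columns of \<open>u\<close> and \<open>last C\<close>,
    \<open>u'\<close> lies in the column of \<open>u\<close>, and the dots of \<open>?N\<close>
    avoid all these columns.\<close>
  have out: "fst z < fst u \<or> fst (last C) \<le> fst z" if "z \<in> ?N" for z
  proof -
    consider "z \<in> set (links B1)" | "z \<in> set (links (last C # B2))" | "z = (fst (last B), snd (hd B))"
      using \<open>z \<in> ?N\<close> by blast
    then show ?thesis
    proof cases
      case 1
      then obtain xs c d zs where B1: "B1 = xs @ c # d # zs" "z = (fst c, snd d)" by (rule in_linksE)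
      then have "fst c < fst d" "d \<in> set B1" using chains(3) by (auto simp: chain_append chain_Cons)
      then show ?thesis using chain_bounds(2)[OF chains(3), of d] B1(2) by simp
    next
      case 2
      then obtain xs c d zs where B2: "last C # B2 = xs @ c # d # zs" "z = (fst c, snd d)" by (rule in_linksE)
      have "chain (last C # B2)"
        using B_props(3) chain_append unfolding B_eq C_B2 by blast
      moreover have "c \<in> set (last C # B2)" unfolding B2(1) by simp
      ultimately show ?thesis using chain_bounds(1)[of "last C # B2" c] B2(2) by simp
    next
      case 3
      have "last C \<in> set B" using C_ne by (simp add: B_eq)
      then show ?thesis using chain_bounds(2)[OF B_props(3)] 3 by simp
    qed
  qed
  have ys_in: "fst u < fst z \<and> fst z < fst (last C)" if "z \<in> set ys \<union> set (links C)" for z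
    using that inner_bounds(1,2) links_C_inner(1,2) assms(2) by blast
  have u_lt: "fst u < fst (last C)" using around_C(1) chain_bounds(2)[OF chains(5), of "hd C"] C_ne by simp
  have "set A1 \<union> set A2 \<subseteq> p - set B" using in_p A1_B A2_B by blast
  then have d1: "(set A1 \<union> set A2) \<inter> (?N \<union> {u'} \<union> set (links C)) = {}"
    using B_shift_new new by blast
  have d2: "u' \<notin> p - set B" using B_shift_new new by blast
  have d3: "u' \<notin> ?N" using out[of u'] u_lt by auto
  have d4: "set ys \<inter> ?N = {}" using out ys_in by (meson UnI1 disjoint_iff leD order_less_asym)
  have d5: "u' \<notin> set (links C)" using ys_in[of u'] by auto
  have sA: "set A = set A1 \<union> set C \<union> set A2" "set C \<subseteq> set B" by (auto simp: A_eq B_eq)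
  have "cyclic_shift (cyclic_shift p B) ?A =
      ((p - set B) \<union> (?N \<union> {u'} \<union> set (links C)) - (set A1 \<union> {u'} \<union> set ys \<union> set A2)) \<union>
      set (links ?A) \<union> {(fst (last A), snd (hd A))}"
    unfolding cyclic_shift_eq[OF B_props(4)] Un_assoc[of "p - set B"] new
    by (subst cyclic_shift_eq) (auto simp: ends)
  also have "\<dots> = double_shift ys"
    unfolding links_A' double_shift_def using d1 d2 d3 d4 d5 sA by blast
  finally show ?thesis .
qed

lemma shifts_eq_double_shift':
  assumes "chain ys" "set ys \<subseteq> Q"
  shows "cyclic_shift (cyclic_shift p A) (B1 @ ys @ w' # B2) = double_shift ys"
proof -
  interpret R: crossing_segment k "prod.swap ` L" "prod.swap ` p" "reflect B" "reflect A"
    "reflect B2" "reflect C" "reflect B1" "reflect A2" "reflect A1" by (rule crossing_segment_reflect)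
  have "set (reflect ys) \<subseteq> R.Q"
    using assms(2) A2_ne B1_ne C_ne by (auto simp: inner_reflect reflect_last reflect_hd)
  then have "cyclic_shift (cyclic_shift (prod.swap ` p) (reflect A)) (reflect (B1 @ ys @ w' # B2)) = R.double_shift (reflect ys)"
    using R.shifts_eq_double_shift[of "reflect ys"] assms(1) A2_ne C_ne by (simp add: reflect_last reflect_hd)
  moreover have "R.double_shift (reflect ys) = prod.swap ` double_shift ys"
  proof -
    have e: "reflect B2 @ [hd (reflect C)] = reflect (last C # B2)" "last (reflect C) # reflect A1 = reflect (A1 @ [hd C])"
      "last (reflect A2) # reflect ys @ [hd (reflect B1)] = reflect (u # ys @ [w])"
      using C_ne A2_ne B1_ne by (simp_all add: reflect_hd reflect_last)
    show ?thesis
      unfolding R.double_shift_def double_shift_def e links_reflect using A_props(4) B_props(4)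
      by (simp add: image_Un image_set_diff inj_swap reflect_hd reflect_last del: reflect_simps(2,3)) blast
  qed
  ultimately have "prod.swap ` cyclic_shift (cyclic_shift p A) (B1 @ ys @ w' # B2) = prod.swap ` double_shift ys"
    using A_props(4) by (simp add: cyclic_shift_reflect del: reflect_simps(2,3))
  then show ?thesis by (metis inj_image_eq_iff inj_swap)
qed

end

context crossing
begin

lemma shifts_commute:
  assumes "A \<noteq> B"
  shows "\<exists>A' B'. greedyA k L (cyclic_shift p B) A' \<and> greedyB k L (cyclic_shift p A) B' \<and>
    cyclic_shift (cyclic_shift p B) A' = cyclic_shift (cyclic_shift p A) B'"
proof (cases "set A \<inter> set B = {}")
  case True
  interpret R: crossing k "prod.swap ` L" "prod.swap ` p" "reflect B" "reflect A" by (rule crossing_reflect)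
  have dis: "set (reflect B) \<inter> set (reflect A) = {}" using True by (auto simp: swap_image_iff)
  have "greedyA k (prod.swap ` L) (prod.swap ` cyclic_shift p A) (reflect B)"
    using R.greedyA_B_shift_disjoint[OF dis] by (simp add: cyclic_shift_reflect A_props(4))
  then have gB': "greedyB k L (cyclic_shift p A) B"
    using greedyB_reflect[OF _ k_pos] by (fastforce simp: image_image)
  have "prod.swap ` cyclic_shift (cyclic_shift p A) B = prod.swap ` cyclic_shift (cyclic_shift p B) A"
    using R.shifts_commute_disjoint[OF dis] unfolding shifts_commute_disjoint[OF True]
    using A_props(4) B_props(4)
    by (simp add: cyclic_shift_reflect links_reflect image_Un image_set_diff inj_swap reflect_hd reflect_last) blast
  then have "cyclic_shift (cyclic_shift p B) A = cyclic_shift (cyclic_shift p A) B"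
    by (metis inj_image_eq_iff inj_swap)
  then show ?thesis using greedyA_B_shift_disjoint[OF True] gB' by blast
next
  case False
  then obtain A1 C A2 B1 B2 where "crossing_segment k L p A B A1 C A2 B1 B2"
    using crossing_segment_exists assms by blast
  then interpret crossing_segment k L p A B A1 C A2 B1 B2 .
  obtain ys where ys: "least_chain Q (length C - 1) ys" using least_exists by blast
  then have "chain ys" "set ys \<subseteq> Q" by (auto simp: least_chain_def)
  then show ?thesis
    using greedyA_B_shift[OF ys] greedyB_A_shift[OF ys] shifts_eq_double_shift shifts_eq_double_shift' by metis
qed

end

theorem theorem10:
  fixes k :: nat and L p :: "(nat \<times> nat) set"
  assumes "k \<ge> 2"
    and "ferrers_board L"
    and "full_rook_placement L p"
    and "contains_pattern k L p"
    and "A_sequence k L p \<noteq> B_sequence k L p"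
  shows "contains_pattern k L (A_shift k L p) \<and>
    contains_pattern k L (B_shift k L p) \<and>
    A_shift k L (B_shift k L p) = B_shift k L (A_shift k L p)"
proof -
  have sub: "p \<subseteq> L" using assms(3) by (simp add: full_rook_placement_def)
  have inj: "inj_on fst p" "inj_on snd p"
  proof -
    show "inj_on fst p"
    proof (rule inj_onI)
      fix c d assume cd: "c \<in> p" "d \<in> p" "fst c = fst d"
      then have "\<exists>!j. (fst c, j) \<in> p" using assms(3) sub unfolding full_rook_placement_def by blast
      then show "c = d" using cd by (metis prod.collapse)
    qed
    show "inj_on snd p"
    proof (rule inj_onI)
      fix c d assume cd: "c \<in> p" "d \<in> p" "snd c = snd d"
      then have "\<exists>!i. (i, snd c) \<in> p" using assms(3) sub unfolding full_rook_placement_def by blast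
      then show "c = d" using cd by (metis prod.collapse)
    qed
  qed
  have k: "k > 0" using assms(1) by simp
  obtain A B where AB: "greedyA k L p A" "greedyB k L p B"
    using greedyA_exists greedyB_exists assms(4) k by blast
  interpret crossing k L p A B
    using assms(2) sub inj k AB by unfold_locales
  have seq: "A_sequence k L p = A" "B_sequence k L p = B"
    using A_sequence_eqI[OF AB(1) inj(2)] B_sequence_eqI[OF AB(2) inj(1)] .
  have shift: "A_shift k L p = cyclic_shift p A" "B_shift k L p = cyclic_shift p B"
    using assms(4) seq by (simp_all add: A_shift_def B_shift_def)
  obtain A' B' where AB': "greedyA k L (cyclic_shift p B) A'" "greedyB k L (cyclic_shift p A) B'"
    "cyclic_shift (cyclic_shift p B) A' = cyclic_shift (cyclic_shift p A) B'"
    using shifts_commute assms(5) unfolding seq by blast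
  \<comment> \<open>The greedy occurrences also witness containment, which the definition of the
    second shift tests.\<close>
  have con: "contains_pattern k L (cyclic_shift p B)" "contains_pattern k L (cyclic_shift p A)"
    using AB' unfolding contains_pattern_def greedyA_def greedyB_def by blast+
  have "A_sequence k L (cyclic_shift p B) = A'" "B_sequence k L (cyclic_shift p A) = B'"
    using A_sequence_eqI[OF AB'(1)] B_sequence_eqI[OF AB'(2)]
      inj_on_cyclic_shift[OF inj B_props(2,3)] inj_on_cyclic_shift[OF inj A_props(2,3)] by blast+
  then show ?thesis
    using con AB'(3) unfolding shift by (simp add: A_shift_def B_shift_def)
qed

end
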